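(* Let $(X,x_0)$ be a pointed type. (i) If $X$ is simply-connected, then the action of $\pi_1(X,x_0)$ on $\pi_n(X,x_0)$ is trivial for all $n\ge 1$. (ii) The fundamental group $\pi_1(X,x_0)$ is abelian if and only if the action of $\pi_1(X,x_0)$ on itself is trivial. (iii) If merely for all loops $p,q:\Omega(X,x_0)$ it holds that $p\cdot q = q\cdot p$, i.e. if the type $\bigl\|\prod_{p,q:\Omega(X,x_0)} p\cdot q = q\cdot p\bigr\|$ is inhabited, then the action of $\pi_1(X,x_0)$ on $\pi_n(X,x_0)$ is trivial for all $n\ge 1$.
   Context: We work in homotopy type theory (Martin-Löf type theory with a univalent universe $\mathsf{Type}$, function extensionality and higher inductive types). $\|A\|$ is propositional truncation and $\|A\|_0$ is set truncation with constructor $|\cdot|_0$. For a type family $P : X\to\mathsf{Type}$, $p : a =_X b$ and $u:P(a)$, $\mathsf{transport}^P(p,u) : P(b)$ is transport; $p\cdot q$ denotes concatenation of paths. $\Omega(X,x_0) := (x_0=_X x_0)$ pointed at $\mathsf{refl}_{x_0}$, $\Omega^{n+1}(X,x_0):=\Omega(\Omega^n(X,x_0))$, and $\pi_n(X,x_0):=\|\Omega^n(X,x_0)\|_0$, with group structure induced by concatenation. A type $X$ is simply-connected if it is connected ($\|x=_X y\|$ is inhabited for all $x,y:X$) and its fundamental group is trivial. The (left) action of $\pi_1(X,x_0)$ on $\pi_n(X,x_0)$ is defined on truncated loops $|p|_0:\pi_1(X,x_0)$ by $|p|_0 . u := \mathsf{transport}^{\pi_n(X,-)}(p^{-1},u)$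 for $u:\pi_n(X,x_0)$; the action of $\pi_1(X,x_0)$ on itself is the case $n=1$. The action is trivial if $p'.u=u$ for all $p':\pi_1(X,x_0)$ and $u:\pi_n(X,x_0)$. *)

theory Defs
  imports Main
begin

(* The object theory is intensional Martin-Loef type theory with a cumulative hierarchy of
   universes a la Russell, function extensionality, univalence, and the higher inductive types
   of propositional truncation and set truncation.  It is embedded deeply: raw terms are
   de Bruijn terms, types and terms share one syntactic category, and a mathematical statement
   is the assertion that a closed type is inhabited.

   As in the presentation with primitive constants, every type former other than the universes
   and dependent products is a constant applied to arguments.  The nat arguments of a constant
   are universe levels: the level of the types it is applied to and, for eliminators, also the
   level of the motive.

   Only the higher inductive types mentioned above are postulated, and there is no judgmental
   eta rule.  Adding further rules can only enlarge the set of inhabited types. *)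

datatype const =
    CEmpty | CEmptyInd nat
  | CUnit | CStar | CUnitInd nat
  | CSum nat | CInl nat | CInr nat | CSumInd nat nat
  | CNat | CZero | CSucc | CNatInd nat
  | CSig nat | CPair nat | CSigInd nat nat
  | CId nat | CRefl nat | CJ nat nat
  | CPTrunc nat | CPIn nat | CPProp nat | CPInd nat nat
  | CSTrunc nat | CSIn nat | CSSet nat | CSInd nat nat
  | CFunext nat
  | CUA nat

datatype tm =
    Var nat
  | U nat
  | Con const
  | Pi tm tm
  | Lam tm tm
  | App tm tm  (infixl "\<degree>" 200)

primrec lift :: "nat \<Rightarrow> nat \<Rightarrow> tm \<Rightarrow> tm" where
  "lift n k (Var x) = (if x < k then Var x else Var (x + n))"
| "lift n k (U i) = U i"
| "lift n k (Con c) = Con c"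
| "lift n k (Pi A B) = Pi (lift n k A) (lift n (Suc k) B)"
| "lift n k (Lam A b) = Lam (lift n k A) (lift n (Suc k) b)"
| "lift n k (f \<degree> a) = lift n k f \<degree> lift n k a"

(* subst k s t replaces index k of t by s and closes the gap; s lives in the context
   without the k innermost variables. *)
primrec subst :: "nat \<Rightarrow> tm \<Rightarrow> tm \<Rightarrow> tm" where
  "subst k s (Var x) = (if x < k then Var x else if x = k then lift k 0 s else Var (x - 1))"
| "subst k s (U i) = U i"
| "subst k s (Con c) = Con c"
| "subst k s (Pi A B) = Pi (subst k s A) (subst (Suc k) s B)"
| "subst k s (Lam A b) = Lam (subst k s A) (subst (Suc k) s b)"
| "subst k s (f \<degree> a) = subst k s f \<degree> subst k s a"


(* Judgmental equality is a relation on raw terms: the congruence generated by beta and by the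
   computation rules of the eliminators at point constructors. *)

inductive conv :: "tm \<Rightarrow> tm \<Rightarrow> bool"  (infix "\<equiv>\<^sub>J" 50) where
  conv_refl: "t \<equiv>\<^sub>J t"
| conv_sym: "s \<equiv>\<^sub>J t \<Longrightarrow> t \<equiv>\<^sub>J s"
| conv_trans: "s \<equiv>\<^sub>J t \<Longrightarrow> t \<equiv>\<^sub>J u \<Longrightarrow> s \<equiv>\<^sub>J u"
| conv_Pi: "A \<equiv>\<^sub>J A' \<Longrightarrow> B \<equiv>\<^sub>J B' \<Longrightarrow> Pi A B \<equiv>\<^sub>J Pi A' B'"
| conv_Lam: "A \<equiv>\<^sub>J A' \<Longrightarrow> b \<equiv>\<^sub>J b' \<Longrightarrow> Lam A b \<equiv>\<^sub>J Lam A' b'"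
| conv_App: "f \<equiv>\<^sub>J f' \<Longrightarrow> a \<equiv>\<^sub>J a' \<Longrightarrow> f \<degree> a \<equiv>\<^sub>J f' \<degree> a'"
| beta: "Lam A b \<degree> a \<equiv>\<^sub>J subst 0 a b"
| iota_unit: "Con (CUnitInd j) \<degree> C \<degree> c \<degree> Con CStar \<equiv>\<^sub>J c"
| iota_inl: "Con (CSumInd i j) \<degree> A \<degree> B \<degree> C \<degree> l \<degree> r \<degree> (Con (CInl i) \<degree> A \<degree> B \<degree> a) \<equiv>\<^sub>J l \<degree> a"
| iota_inr: "Con (CSumInd i j) \<degree> A \<degree> B \<degree> C \<degree> l \<degree> r \<degree> (Con (CInr i) \<degree> A \<degree> B \<degree> b) \<equiv>\<^sub>J r \<degree> b"
| iota_zero: "Con (CNatInd j) \<degree> C \<degree> z \<degree> s \<degree> Con CZero \<equiv>\<^sub>J z"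
| iota_succ: "Con (CNatInd j) \<degree> C \<degree> z \<degree> s \<degree> (Con CSucc \<degree> n)
              \<equiv>\<^sub>J s \<degree> n \<degree> (Con (CNatInd j) \<degree> C \<degree> z \<degree> s \<degree> n)"
| iota_pair: "Con (CSigInd i j) \<degree> A \<degree> B \<degree> C \<degree> g \<degree> (Con (CPair i) \<degree> A \<degree> B \<degree> a \<degree> b)
              \<equiv>\<^sub>J g \<degree> a \<degree> b"
| iota_refl: "Con (CJ i j) \<degree> A \<degree> C \<degree> c \<degree> a \<degree> a \<degree> (Con (CRefl i) \<degree> A \<degree> a) \<equiv>\<^sub>J c \<degree> a"
| iota_ptrunc: "Con (CPInd i j) \<degree> A \<degree> C \<degree> h \<degree> g \<degree> (Con (CPIn i) \<degree> A \<degree> a) \<equiv>\<^sub>J g \<degree> a"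
| iota_strunc: "Con (CSInd i j) \<degree> A \<degree> C \<degree> h \<degree> g \<degree> (Con (CSIn i) \<degree> A \<degree> a) \<equiv>\<^sub>J g \<degree> a"


(* Concrete terms are written with HOL binders.  An expression maps the length of the ambient
   context to a raw term, so that a variable bound at depth n and used at depth m becomes the
   de Bruijn index m - n - 1.  A closed expression e denotes the raw term e 0. *)

type_synonym exp = "nat \<Rightarrow> tm"

definition PiE :: "exp \<Rightarrow> (exp \<Rightarrow> exp) \<Rightarrow> exp" where
  "PiE A B = (\<lambda>n. Pi (A n) (B (\<lambda>m. Var (m - Suc n)) (Suc n)))"

definition LamE :: "exp \<Rightarrow> (exp \<Rightarrow> exp) \<Rightarrow> exp" where
  "LamE A b = (\<lambda>n. Lam (A n) (b (\<lambda>m. Var (m - Suc n)) (Suc n)))"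

definition AppE :: "exp \<Rightarrow> exp \<Rightarrow> exp"  (infixl "\<cdot>" 200) where
  "f \<cdot> a = (\<lambda>n. f n \<degree> a n)"

definition K :: "const \<Rightarrow> exp" where
  "K c = (\<lambda>n. Con c)"

definition Type :: "nat \<Rightarrow> exp" where
  "Type i = (\<lambda>n. U i)"

syntax
  "_PiE" :: "pttrn \<Rightarrow> exp \<Rightarrow> exp \<Rightarrow> exp"  ("(3\<^bold>\<Pi> _ : _./ _)" [0, 11, 10] 10)
  "_LamE" :: "pttrn \<Rightarrow> exp \<Rightarrow> exp \<Rightarrow> exp"  ("(3\<^bold>\<lambda> _ : _./ _)" [0, 11, 10] 10)
translations
  "\<^bold>\<Pi> x : A. B" \<rightleftharpoons> "CONST PiE A (\<lambda>x. B)"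
  "\<^bold>\<lambda> x : A. b" \<rightleftharpoons> "CONST LamE A (\<lambda>x. b)"

definition ArrE :: "exp \<Rightarrow> exp \<Rightarrow> exp"  (infixr "\<rightarrow>" 60) where
  "A \<rightarrow> B = (\<^bold>\<Pi> _ : A. B)"

definition NatE :: exp where "NatE = K CNat"
definition zeroE :: exp where "zeroE = K CZero"
definition succE :: "exp \<Rightarrow> exp" where "succE n = K CSucc \<cdot> n"

definition SigE :: "nat \<Rightarrow> exp \<Rightarrow> (exp \<Rightarrow> exp) \<Rightarrow> exp" where
  "SigE i A B = K (CSig i) \<cdot> A \<cdot> (\<^bold>\<lambda> x : A. B x)"

definition pairE :: "nat \<Rightarrow> exp \<Rightarrow> (exp \<Rightarrow> exp) \<Rightarrow> exp \<Rightarrow> exp \<Rightarrow> exp" where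
  "pairE i A B a b = K (CPair i) \<cdot> A \<cdot> (\<^bold>\<lambda> x : A. B x) \<cdot> a \<cdot> b"

definition fstE :: "nat \<Rightarrow> exp \<Rightarrow> (exp \<Rightarrow> exp) \<Rightarrow> exp \<Rightarrow> exp" where
  "fstE i A B p = K (CSigInd i i) \<cdot> A \<cdot> (\<^bold>\<lambda> x : A. B x) \<cdot> (\<^bold>\<lambda> _ : SigE i A B. A)
                    \<cdot> (\<^bold>\<lambda> a : A. \<^bold>\<lambda> b : B a. a) \<cdot> p"

definition sndE :: "nat \<Rightarrow> exp \<Rightarrow> (exp \<Rightarrow> exp) \<Rightarrow> exp \<Rightarrow> exp" where
  "sndE i A B p = K (CSigInd i i) \<cdot> A \<cdot> (\<^bold>\<lambda> x : A. B x) \<cdot> (\<^bold>\<lambda> q : SigE i A B. B (fstE i A B q))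
                    \<cdot> (\<^bold>\<lambda> a : A. \<^bold>\<lambda> b : B a. b) \<cdot> p"

definition ProdE :: "nat \<Rightarrow> exp \<Rightarrow> exp \<Rightarrow> exp" where
  "ProdE i A B = SigE i A (\<lambda>_. B)"

definition EqE :: "nat \<Rightarrow> exp \<Rightarrow> exp \<Rightarrow> exp \<Rightarrow> exp" where
  "EqE i A x y = K (CId i) \<cdot> A \<cdot> x \<cdot> y"

definition reflE :: "nat \<Rightarrow> exp \<Rightarrow> exp \<Rightarrow> exp" where
  "reflE i A x = K (CRefl i) \<cdot> A \<cdot> x"

definition PTruncE :: "nat \<Rightarrow> exp \<Rightarrow> exp" where
  "PTruncE i A = K (CPTrunc i) \<cdot> A"

definition STruncE :: "nat \<Rightarrow> exp \<Rightarrow> exp" where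
  "STruncE i A = K (CSTrunc i) \<cdot> A"

definition sinE :: "nat \<Rightarrow> exp \<Rightarrow> exp \<Rightarrow> exp" where
  "sinE i A a = K (CSIn i) \<cdot> A \<cdot> a"

definition isProp :: "nat \<Rightarrow> exp \<Rightarrow> exp" where
  "isProp i A = (\<^bold>\<Pi> x : A. \<^bold>\<Pi> y : A. EqE i A x y)"

definition isSet :: "nat \<Rightarrow> exp \<Rightarrow> exp" where
  "isSet i A = (\<^bold>\<Pi> x : A. \<^bold>\<Pi> y : A. isProp i (EqE i A x y))"

(* A map is an equivalence if it has a right inverse and a left inverse (bi-invertibility). *)
definition isEquiv :: "nat \<Rightarrow> exp \<Rightarrow> exp \<Rightarrow> exp \<Rightarrow> exp" where
  "isEquiv i A B f = ProdE i
     (SigE i (B \<rightarrow> A) (\<lambda>g. \<^bold>\<Pi> y : B. EqE i B (f \<cdot> (g \<cdot> y)) y))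
     (SigE i (B \<rightarrow> A) (\<lambda>h. \<^bold>\<Pi> x : A. EqE i A (h \<cdot> (f \<cdot> x)) x))"

definition Equiv :: "nat \<Rightarrow> exp \<Rightarrow> exp \<Rightarrow> exp" where
  "Equiv i A B = SigE i (A \<rightarrow> B) (\<lambda>f. isEquiv i A B f)"

definition idE :: "exp \<Rightarrow> exp" where
  "idE A = (\<^bold>\<lambda> x : A. x)"

definition idEquiv :: "nat \<Rightarrow> exp \<Rightarrow> exp" where
  "idEquiv i A =
     (let H = (\<lambda>g. \<^bold>\<Pi> x : A. EqE i A (idE A \<cdot> (g \<cdot> x)) x);
          H' = (\<lambda>h. \<^bold>\<Pi> x : A. EqE i A (h \<cdot> (idE A \<cdot> x)) x);
          r = (\<^bold>\<lambda> x : A. reflE i A x)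
      in pairE i (A \<rightarrow> A) (\<lambda>f. isEquiv i A A f) (idE A)
           (pairE i (SigE i (A \<rightarrow> A) H) (\<lambda>_. SigE i (A \<rightarrow> A) H')
              (pairE i (A \<rightarrow> A) H (idE A) r)
              (pairE i (A \<rightarrow> A) H' (idE A) r)))"

definition idtoeqv :: "nat \<Rightarrow> exp \<Rightarrow> exp \<Rightarrow> exp" where
  "idtoeqv i A B = (\<^bold>\<lambda> p : EqE (Suc i) (Type i) A B.
     K (CJ (Suc i) i) \<cdot> Type i
       \<cdot> (\<^bold>\<lambda> X : Type i. \<^bold>\<lambda> Y : Type i. \<^bold>\<lambda> _ : EqE (Suc i) (Type i) X Y. Equiv i X Y)
       \<cdot> (\<^bold>\<lambda> X : Type i. idEquiv i X) \<cdot> A \<cdot> B \<cdot> p)"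

definition happly :: "nat \<Rightarrow> exp \<Rightarrow> (exp \<Rightarrow> exp) \<Rightarrow> exp \<Rightarrow> exp \<Rightarrow> exp" where
  "happly i A B f g =
     (let F = (\<^bold>\<Pi> x : A. B x) in
      \<^bold>\<lambda> p : EqE i F f g.
        K (CJ i i) \<cdot> F
          \<cdot> (\<^bold>\<lambda> h : F. \<^bold>\<lambda> k : F. \<^bold>\<lambda> _ : EqE i F h k. \<^bold>\<Pi> x : A. EqE i (B x) (h \<cdot> x) (k \<cdot> x))
          \<cdot> (\<^bold>\<lambda> h : F. \<^bold>\<lambda> x : A. reflE i (B x) (h \<cdot> x)) \<cdot> f \<cdot> g \<cdot> p)"


(* The truncations have their usual dependent eliminators into families of propositions and of
   sets, respectively; their path constructors are CPProp and CSSet.  All types below are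
   closed, so they need no lifting when used in a context. *)

fun ctypeE :: "const \<Rightarrow> exp" where
  "ctypeE CEmpty = Type 0"
| "ctypeE (CEmptyInd j) = (\<^bold>\<Pi> C : K CEmpty \<rightarrow> Type j. \<^bold>\<Pi> x : K CEmpty. C \<cdot> x)"
| "ctypeE CUnit = Type 0"
| "ctypeE CStar = K CUnit"
| "ctypeE (CUnitInd j) =
     (\<^bold>\<Pi> C : K CUnit \<rightarrow> Type j. C \<cdot> K CStar \<rightarrow> (\<^bold>\<Pi> x : K CUnit. C \<cdot> x))"
| "ctypeE (CSum i) = Type i \<rightarrow> Type i \<rightarrow> Type i"
| "ctypeE (CInl i) = (\<^bold>\<Pi> A : Type i. \<^bold>\<Pi> B : Type i. A \<rightarrow> K (CSum i) \<cdot> A \<cdot> B)"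
| "ctypeE (CInr i) = (\<^bold>\<Pi> A : Type i. \<^bold>\<Pi> B : Type i. B \<rightarrow> K (CSum i) \<cdot> A \<cdot> B)"
| "ctypeE (CSumInd i j) =
     (\<^bold>\<Pi> A : Type i. \<^bold>\<Pi> B : Type i. \<^bold>\<Pi> C : K (CSum i) \<cdot> A \<cdot> B \<rightarrow> Type j.
        (\<^bold>\<Pi> a : A. C \<cdot> (K (CInl i) \<cdot> A \<cdot> B \<cdot> a)) \<rightarrow>
        (\<^bold>\<Pi> b : B. C \<cdot> (K (CInr i) \<cdot> A \<cdot> B \<cdot> b)) \<rightarrow>
        (\<^bold>\<Pi> x : K (CSum i) \<cdot> A \<cdot> B. C \<cdot> x))"
| "ctypeE CNat = Type 0"
| "ctypeE CZero = NatE"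
| "ctypeE CSucc = NatE \<rightarrow> NatE"
| "ctypeE (CNatInd j) =
     (\<^bold>\<Pi> C : NatE \<rightarrow> Type j. C \<cdot> zeroE \<rightarrow> (\<^bold>\<Pi> n : NatE. C \<cdot> n \<rightarrow> C \<cdot> succE n) \<rightarrow>
        (\<^bold>\<Pi> n : NatE. C \<cdot> n))"
| "ctypeE (CSig i) = (\<^bold>\<Pi> A : Type i. (A \<rightarrow> Type i) \<rightarrow> Type i)"
| "ctypeE (CPair i) =
     (\<^bold>\<Pi> A : Type i. \<^bold>\<Pi> B : A \<rightarrow> Type i. \<^bold>\<Pi> a : A. B \<cdot> a \<rightarrow> K (CSig i) \<cdot> A \<cdot> B)"
| "ctypeE (CSigInd i j) =
     (\<^bold>\<Pi> A : Type i. \<^bold>\<Pi> B : A \<rightarrow> Type i. \<^bold>\<Pi> C : K (CSig i) \<cdot> A \<cdot> B \<rightarrow> Type j.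
        (\<^bold>\<Pi> a : A. \<^bold>\<Pi> b : B \<cdot> a. C \<cdot> (K (CPair i) \<cdot> A \<cdot> B \<cdot> a \<cdot> b)) \<rightarrow>
        (\<^bold>\<Pi> p : K (CSig i) \<cdot> A \<cdot> B. C \<cdot> p))"
| "ctypeE (CId i) = (\<^bold>\<Pi> A : Type i. A \<rightarrow> A \<rightarrow> Type i)"
| "ctypeE (CRefl i) = (\<^bold>\<Pi> A : Type i. \<^bold>\<Pi> x : A. EqE i A x x)"
| "ctypeE (CJ i j) =
     (\<^bold>\<Pi> A : Type i. \<^bold>\<Pi> C : (\<^bold>\<Pi> x : A. \<^bold>\<Pi> y : A. EqE i A x y \<rightarrow> Type j).
        (\<^bold>\<Pi> x : A. C \<cdot> x \<cdot> x \<cdot> reflE i A x) \<rightarrow>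
        (\<^bold>\<Pi> x : A. \<^bold>\<Pi> y : A. \<^bold>\<Pi> p : EqE i A x y. C \<cdot> x \<cdot> y \<cdot> p))"
| "ctypeE (CPTrunc i) = Type i \<rightarrow> Type i"
| "ctypeE (CPIn i) = (\<^bold>\<Pi> A : Type i. A \<rightarrow> PTruncE i A)"
| "ctypeE (CPProp i) = (\<^bold>\<Pi> A : Type i. isProp i (PTruncE i A))"
| "ctypeE (CPInd i j) =
     (\<^bold>\<Pi> A : Type i. \<^bold>\<Pi> C : PTruncE i A \<rightarrow> Type j.
        (\<^bold>\<Pi> x : PTruncE i A. isProp j (C \<cdot> x)) \<rightarrow>
        (\<^bold>\<Pi> a : A. C \<cdot> (K (CPIn i) \<cdot> A \<cdot> a)) \<rightarrow>
        (\<^bold>\<Pi> x : PTruncE i A. C \<cdot> x))"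
| "ctypeE (CSTrunc i) = Type i \<rightarrow> Type i"
| "ctypeE (CSIn i) = (\<^bold>\<Pi> A : Type i. A \<rightarrow> STruncE i A)"
| "ctypeE (CSSet i) = (\<^bold>\<Pi> A : Type i. isSet i (STruncE i A))"
| "ctypeE (CSInd i j) =
     (\<^bold>\<Pi> A : Type i. \<^bold>\<Pi> C : STruncE i A \<rightarrow> Type j.
        (\<^bold>\<Pi> x : STruncE i A. isSet j (C \<cdot> x)) \<rightarrow>
        (\<^bold>\<Pi> a : A. C \<cdot> sinE i A a) \<rightarrow>
        (\<^bold>\<Pi> x : STruncE i A. C \<cdot> x))"
| "ctypeE (CFunext i) =
     (\<^bold>\<Pi> A : Type i. \<^bold>\<Pi> B : A \<rightarrow> Type i.
      \<^bold>\<Pi> f : (\<^bold>\<Pi> x : A. B \<cdot> x). \<^bold>\<Pi> g : (\<^bold>\<Pi> x : A. B \<cdot> x).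
        isEquiv i (EqE i (\<^bold>\<Pi> x : A. B \<cdot> x) f g) (\<^bold>\<Pi> x : A. EqE i (B \<cdot> x) (f \<cdot> x) (g \<cdot> x))
          (happly i A (\<lambda>x. B \<cdot> x) f g))"
| "ctypeE (CUA i) =
     (\<^bold>\<Pi> A : Type i. \<^bold>\<Pi> B : Type i.
        isEquiv (Suc i) (EqE (Suc i) (Type i) A B) (Equiv i A B) (idtoeqv i A B))"

definition ctype :: "const \<Rightarrow> tm" where
  "ctype c = ctypeE c 0"


(* The head of the list is the most recently declared variable. *)

inductive ctx :: "tm list \<Rightarrow> bool"
  and typing :: "tm list \<Rightarrow> tm \<Rightarrow> tm \<Rightarrow> bool"  ("_ \<turnstile> _ : _" [50, 50, 50] 50)
where
  ctx_Nil: "ctx []"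
| ctx_Cons: "\<Gamma> \<turnstile> A : U i \<Longrightarrow> ctx (A # \<Gamma>)"
| ty_Var: "ctx \<Gamma> \<Longrightarrow> k < length \<Gamma> \<Longrightarrow> \<Gamma> \<turnstile> Var k : lift (Suc k) 0 (\<Gamma> ! k)"
| ty_U: "ctx \<Gamma> \<Longrightarrow> \<Gamma> \<turnstile> U i : U (Suc i)"
| ty_cumul: "\<Gamma> \<turnstile> A : U i \<Longrightarrow> \<Gamma> \<turnstile> A : U (Suc i)"
| ty_Con: "ctx \<Gamma> \<Longrightarrow> \<Gamma> \<turnstile> Con c : ctype c"
| ty_Pi: "\<Gamma> \<turnstile> A : U i \<Longrightarrow> A # \<Gamma> \<turnstile> B : U i \<Longrightarrow> \<Gamma> \<turnstile> Pi A B : U i"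
| ty_Lam: "A # \<Gamma> \<turnstile> b : B \<Longrightarrow> \<Gamma> \<turnstile> Lam A b : Pi A B"
| ty_App: "\<Gamma> \<turnstile> f : Pi A B \<Longrightarrow> \<Gamma> \<turnstile> a : A \<Longrightarrow> \<Gamma> \<turnstile> f \<degree> a : subst 0 a B"
| ty_conv: "\<Gamma> \<turnstile> a : A \<Longrightarrow> A \<equiv>\<^sub>J B \<Longrightarrow> \<Gamma> \<turnstile> B : U i \<Longrightarrow> \<Gamma> \<turnstile> a : B"

definition inhabited :: "exp \<Rightarrow> bool" where
  "inhabited T \<longleftrightarrow> (\<exists>t. [] \<turnstile> t : T 0)"


definition transportE :: "nat \<Rightarrow> exp \<Rightarrow> (exp \<Rightarrow> exp) \<Rightarrow> exp \<Rightarrow> exp \<Rightarrow> exp \<Rightarrow> exp \<Rightarrow> exp" where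
  "transportE i A P a b p u =
     K (CJ i i) \<cdot> A
       \<cdot> (\<^bold>\<lambda> x : A. \<^bold>\<lambda> y : A. \<^bold>\<lambda> _ : EqE i A x y. P x \<rightarrow> P y)
       \<cdot> (\<^bold>\<lambda> x : A. \<^bold>\<lambda> v : P x. v) \<cdot> a \<cdot> b \<cdot> p \<cdot> u"

definition invE :: "nat \<Rightarrow> exp \<Rightarrow> exp \<Rightarrow> exp \<Rightarrow> exp \<Rightarrow> exp" where
  "invE i A a b p =
     K (CJ i i) \<cdot> A
       \<cdot> (\<^bold>\<lambda> x : A. \<^bold>\<lambda> y : A. \<^bold>\<lambda> _ : EqE i A x y. EqE i A y x)
       \<cdot> (\<^bold>\<lambda> x : A. reflE i A x) \<cdot> a \<cdot> b \<cdot> p"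

definition concatE :: "nat \<Rightarrow> exp \<Rightarrow> exp \<Rightarrow> exp \<Rightarrow> exp \<Rightarrow> exp \<Rightarrow> exp \<Rightarrow> exp" where
  "concatE i A a b c p q =
     K (CJ i i) \<cdot> A
       \<cdot> (\<^bold>\<lambda> x : A. \<^bold>\<lambda> y : A. \<^bold>\<lambda> _ : EqE i A x y. \<^bold>\<Pi> z : A. EqE i A y z \<rightarrow> EqE i A x z)
       \<cdot> (\<^bold>\<lambda> x : A. \<^bold>\<lambda> z : A. \<^bold>\<lambda> r : EqE i A x z. r) \<cdot> a \<cdot> b \<cdot> p \<cdot> c \<cdot> q"


definition PtdE :: "nat \<Rightarrow> exp" where
  "PtdE i = SigE (Suc i) (Type i) (\<lambda>A. A)"

definition ptdE :: "nat \<Rightarrow> exp \<Rightarrow> exp \<Rightarrow> exp" where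
  "ptdE i X x0 = pairE (Suc i) (Type i) (\<lambda>A. A) X x0"

definition carrierE :: "nat \<Rightarrow> exp \<Rightarrow> exp" where
  "carrierE i P = fstE (Suc i) (Type i) (\<lambda>A. A) P"

definition pointE :: "nat \<Rightarrow> exp \<Rightarrow> exp" where
  "pointE i P = sndE (Suc i) (Type i) (\<lambda>A. A) P"

definition LoopE :: "nat \<Rightarrow> exp \<Rightarrow> exp" where
  "LoopE i P = ptdE i (EqE i (carrierE i P) (pointE i P) (pointE i P))
                      (reflE i (carrierE i P) (pointE i P))"

(* Iteration adds the new loop space on the outside: the (n+1)-st is LoopE of the n-th. *)
definition LoopnE :: "nat \<Rightarrow> exp \<Rightarrow> exp \<Rightarrow> exp \<Rightarrow> exp" where
  "LoopnE i n X x0 =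
     K (CNatInd (Suc i)) \<cdot> (\<^bold>\<lambda> _ : NatE. PtdE i) \<cdot> ptdE i X x0
       \<cdot> (\<^bold>\<lambda> _ : NatE. \<^bold>\<lambda> P : PtdE i. LoopE i P) \<cdot> n"

definition oneE :: exp where "oneE = succE zeroE"

definition piE :: "nat \<Rightarrow> exp \<Rightarrow> exp \<Rightarrow> exp \<Rightarrow> exp" where
  "piE i n X x0 = STruncE i (carrierE i (LoopnE i n X x0))"

definition pi_unitE :: "nat \<Rightarrow> exp \<Rightarrow> exp \<Rightarrow> exp \<Rightarrow> exp" where
  "pi_unitE i n X x0 = sinE i (carrierE i (LoopnE i n X x0)) (pointE i (LoopnE i n X x0))"

(* Non-dependent elimination of the set truncation of A into the set truncation of B. *)
definition srecE :: "nat \<Rightarrow> exp \<Rightarrow> exp \<Rightarrow> (exp \<Rightarrow> exp) \<Rightarrow> exp \<Rightarrow> exp" where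
  "srecE i A B f x =
     K (CSInd i i) \<cdot> A \<cdot> (\<^bold>\<lambda> _ : STruncE i A. STruncE i B)
       \<cdot> (\<^bold>\<lambda> _ : STruncE i A. K (CSSet i) \<cdot> B) \<cdot> (\<^bold>\<lambda> a : A. f a) \<cdot> x"

(* Multiplication of the (n+1)-st homotopy group, induced by concatenation of loops. *)
definition pi_multE :: "nat \<Rightarrow> exp \<Rightarrow> exp \<Rightarrow> exp \<Rightarrow> exp \<Rightarrow> exp \<Rightarrow> exp" where
  "pi_multE i n X x0 g h =
     (let P = LoopnE i n X x0; A = carrierE i P; a = pointE i P; L = EqE i A a a
      in srecE i L L (\<lambda>p. srecE i L L (\<lambda>q. sinE i L (concatE i A a a a p q)) h) g)"

(* The action of the fundamental group, |p|.u = transport (p^-1) u. *)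
definition actE :: "nat \<Rightarrow> exp \<Rightarrow> exp \<Rightarrow> exp \<Rightarrow> exp \<Rightarrow> exp \<Rightarrow> exp" where
  "actE i n X x0 g u =
     srecE i (carrierE i (LoopnE i oneE X x0)) (carrierE i (LoopnE i n X x0))
       (\<lambda>p. transportE i X (\<lambda>x. piE i n X x) x0 x0 (invE i X x0 x0 p) u) g"

definition trivial_action :: "nat \<Rightarrow> exp \<Rightarrow> exp \<Rightarrow> exp \<Rightarrow> exp" where
  "trivial_action i n X x0 =
     (\<^bold>\<Pi> g : piE i oneE X x0. \<^bold>\<Pi> u : piE i n X x0. EqE i (piE i n X x0) (actE i n X x0 g u) u)"

definition connected :: "nat \<Rightarrow> exp \<Rightarrow> exp" where
  "connected i X = (\<^bold>\<Pi> x : X. \<^bold>\<Pi> y : X. PTruncE i (EqE i X x y))"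

definition trivial_pi1 :: "nat \<Rightarrow> exp \<Rightarrow> exp \<Rightarrow> exp" where
  "trivial_pi1 i X x0 = (\<^bold>\<Pi> g : piE i oneE X x0. EqE i (piE i oneE X x0) g (pi_unitE i oneE X x0))"

definition simply_connected :: "nat \<Rightarrow> exp \<Rightarrow> exp \<Rightarrow> exp" where
  "simply_connected i X x0 = ProdE i (connected i X) (trivial_pi1 i X x0)"

definition abelian_pi1 :: "nat \<Rightarrow> exp \<Rightarrow> exp \<Rightarrow> exp" where
  "abelian_pi1 i X x0 =
     (\<^bold>\<Pi> g : piE i oneE X x0. \<^bold>\<Pi> h : piE i oneE X x0.
        EqE i (piE i oneE X x0) (pi_multE i zeroE X x0 g h) (pi_multE i zeroE X x0 h g))"

definition loops_commute :: "nat \<Rightarrow> exp \<Rightarrow> exp \<Rightarrow> exp" where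
  "loops_commute i X x0 =
     (\<^bold>\<Pi> p : EqE i X x0 x0. \<^bold>\<Pi> q : EqE i X x0 x0.
        EqE i (EqE i X x0 x0) (concatE i X x0 x0 x0 p q) (concatE i X x0 x0 x0 q p))"

end

theory Submission
  imports Defs
begin

text \<open>The three clauses say that certain closed types of the embedded type theory are inhabited. The proof writes down the
inhabitants as terms and has two halves: one that makes checking such terms feasible, and the homotopy theory.

\<^bold>\<open>Checking terms.\<close> The function \<open>tc\<close> is a type checker, proved sound in \<open>tc_sound\<close> from weakening and substitution for the
typing judgment (\<open>typing_weaken\<close>, \<open>typing_subst\<close>). Judgmental equality is tested by reducing both sides, and a \<open>Pi\<close> type
that was obtained by reduction is checked again before it is used, in place of an appeal to subject reduction. The
functions of the checker inspect their arguments by constructor patterns only, so that their equations are unconditional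
rewrite rules and the simplifier evaluates the checker on a concrete proof term, with the universe level kept symbolic.
A law of type theory is then proved by exhibiting a term; later terms refer to it through a hypothesis, which is
discharged by application (\<open>inhabited_mp\<close>).

\<^bold>\<open>Homotopy theory.\<close> If the fundamental group is trivial, every element is equal to the class of reflexivity, which acts as
the identity by computation; this is the first clause. For the second, path induction on \<open>r : x = y\<close> shows that
the class of a loop \<open>q\<close> at \<open>y\<close> is transported back along \<open>r\<close> to the class of \<open>q'\<close> exactly when \<open>r\<close> followed by \<open>q\<close> and \<open>q'\<close>
followed by \<open>r\<close> have the same class (\<open>comm_fixed\<close>, \<open>fixed_comm\<close>). Taking \<open>y = x\<close> and \<open>q' = q\<close> gives both directions.

For the third clause, fix a loop \<open>r\<close> and regard transport around \<open>r\<close> in the iterated loop spaces as a sequence of pointed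
maps. Each is obtained from the previous one by the loop space functor (\<open>loop_fibre_map\<close>), and the functor preserves
the identity, so it is enough that the first one is equal to the identity as a pointed map. The first one is conjugation by
\<open>r\<close>, and commutativity of loops provides a homotopy from it to the identity which has no reason to respect the base points. In a
loop space this can be repaired (\<open>free_pointed\<close>), because a loop at reflexivity extends to a family of loops at all points.
The conclusion is a proposition, so it does not matter that commutativity holds only merely.\<close>

section \<open>Weakening and substitution\<close>

text \<open>The usual commutation laws of de Bruijn lifting and substitution. They are stated for arbitrary cutoffs because
the inductions pass under binders.\<close>

lemma lift_0 [simp]: "lift 0 k t = t"
  by (induction t arbitrary: k) auto

lemma lift_lift_add: "k \<le> j \<Longrightarrow> j \<le> k + m \<Longrightarrow> lift n j (lift m k t) = lift (n + m) k t"
proof (induction t arbitrary: k j)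
  case (Pi A B) then show ?case using Pi.IH(2)[of "Suc k" "Suc j"] by simp
next
  case (Lam A B) then show ?case using Lam.IH(2)[of "Suc k" "Suc j"] by simp
qed auto

lemma lift_lift_comm: "j \<le> k \<Longrightarrow> lift n (k + m) (lift m j t) = lift m j (lift n k t)"
proof (induction t arbitrary: k j)
  case (Pi A B) then show ?case using Pi.IH(2)[of "Suc j" "Suc k"] by simp
next
  case (Lam A B) then show ?case using Lam.IH(2)[of "Suc j" "Suc k"] by simp
qed auto

lemma lift_subst: "lift n (k + j) (subst j a t) = subst j (lift n k a) (lift n (Suc (k + j)) t)"
proof (induction t arbitrary: j)
  case (Var x) then show ?case using lift_lift_comm[of 0 k n j a] by auto
next
  case (Pi A B) then show ?case using Pi.IH(2)[of "Suc j"] by simp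
next
  case (Lam A B) then show ?case using Lam.IH(2)[of "Suc j"] by simp
qed auto

lemma subst_lift: "j \<le> k \<Longrightarrow> k \<le> j + n \<Longrightarrow> subst k s (lift (Suc n) j t) = lift n j t"
proof (induction t arbitrary: k j)
  case (Pi A B) then show ?case using Pi.IH(2)[of "Suc j" "Suc k"] by simp
next
  case (Lam A B) then show ?case using Lam.IH(2)[of "Suc j" "Suc k"] by simp
qed auto

lemma subst_lift_comm: "j \<le> k \<Longrightarrow> subst (k + m) s (lift m j t) = lift m j (subst k s t)"
proof (induction t arbitrary: k j)
  case (Var x) then show ?case using lift_lift_add[of 0 j k m s] by (auto simp: add.commute)
next
  case (Pi A B) then show ?case using Pi.IH(2)[of "Suc j" "Suc k"] by simp
next
  case (Lam A B) then show ?case using Lam.IH(2)[of "Suc j" "Suc k"] by simp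
qed auto

lemma subst_subst: "subst (j + k) s (subst j a t) = subst j (subst k s a) (subst (Suc (j + k)) s t)"
proof (induction t arbitrary: j)
  case (Var x)
  have 1: "subst (j + k) s (lift j 0 a) = lift j 0 (subst k s a)"
    using subst_lift_comm[of 0 k j s a] by (simp add: add.commute)
  have 2: "subst j (subst k s a) (lift (Suc (j + k)) 0 s) = lift (j + k) 0 s"
    by (rule subst_lift) auto
  show ?case using 1 2 by auto
next
  case (Pi A B) then show ?case using Pi.IH(2)[of "Suc j"] by simp
next
  case (Lam A B) then show ?case using Lam.IH(2)[of "Suc j"] by simp
qed auto

lemma conv_lift: "s \<equiv>\<^sub>J t \<Longrightarrow> lift n k s \<equiv>\<^sub>J lift n k t"
proof (induction arbitrary: k rule: conv.induct)
  case (beta A b a)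
  then show ?case using lift_subst[of n k 0 a b] by (auto intro: conv.beta)
qed (auto intro: conv.intros)

lemma conv_subst: "s \<equiv>\<^sub>J t \<Longrightarrow> subst k u s \<equiv>\<^sub>J subst k u t"
proof (induction arbitrary: k rule: conv.induct)
  case (beta A b a)
  then show ?case using subst_subst[of 0 k u a b] by simp (metis conv.beta)
qed (auto intro: conv.intros)

text \<open>All of these unfold a binder expression into a raw term. The iterated loop space is left out: its unfolding is
controlled separately below, where a repeated closed subterm is kept folded.\<close>

lemmas exp_defs = PiE_def LamE_def AppE_def K_def Type_def ArrE_def NatE_def zeroE_def succE_def SigE_def
  pairE_def fstE_def sndE_def ProdE_def EqE_def reflE_def PTruncE_def STruncE_def sinE_def isProp_def isSet_def
  isEquiv_def Equiv_def idE_def idEquiv_def idtoeqv_def happly_def transportE_def invE_def concatE_def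
  PtdE_def ptdE_def carrierE_def pointE_def LoopE_def oneE_def piE_def pi_unitE_def srecE_def
  pi_multE_def actE_def trivial_action_def connected_def trivial_pi1_def simply_connected_def abelian_pi1_def
  loops_commute_def Let_def

lemma lift_ctype [simp]: "lift n k (ctype c) = ctype c"
  by (cases c) (simp_all add: ctype_def exp_defs)

lemma subst_ctype [simp]: "subst k s (ctype c) = ctype c"
  by (cases c) (simp_all add: ctype_def exp_defs)

text \<open>Inserting a declaration below \<open>\<Delta>\<close>, or substituting for one, affects each entry of \<open>\<Delta>\<close> at a different index,
namely at the number of entries that were declared before it.\<close>

primrec lift_ctx :: "tm list \<Rightarrow> tm list" where
  "lift_ctx [] = []"
| "lift_ctx (B # \<Delta>) = lift 1 (length \<Delta>) B # lift_ctx \<Delta>"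

primrec subst_ctx :: "tm \<Rightarrow> tm list \<Rightarrow> tm list" where
  "subst_ctx s [] = []"
| "subst_ctx s (B # \<Delta>) = subst (length \<Delta>) s B # subst_ctx s \<Delta>"

lemma length_lift_ctx [simp]: "length (lift_ctx \<Delta>) = length \<Delta>"
  by (induction \<Delta>) auto

lemma length_subst_ctx [simp]: "length (subst_ctx s \<Delta>) = length \<Delta>"
  by (induction \<Delta>) auto

lemma nth_lift_ctx: "k < length \<Delta> \<Longrightarrow> lift_ctx \<Delta> ! k = lift 1 (length \<Delta> - Suc k) (\<Delta> ! k)"
  by (induction \<Delta> arbitrary: k) (auto simp: nth_Cons split: nat.split)

lemma nth_subst_ctx: "k < length \<Delta> \<Longrightarrow> subst_ctx s \<Delta> ! k = subst (length \<Delta> - Suc k) s (\<Delta> ! k)"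
  by (induction \<Delta> arbitrary: k) (auto simp: nth_Cons split: nat.split)

lemma all_drop_Cons: "(\<forall>n. P (drop n (x # xs))) \<longleftrightarrow> P (x # xs) \<and> (\<forall>n. P (drop n xs))"
  by (metis drop0 drop_Suc_Cons not0_implies_Suc)

text \<open>The context of a derivable judgment is well formed, and so are all its tails; the tails are needed at
the abstraction rule, whose premise has a longer context than its conclusion.\<close>

lemma ctx_drop: "ctx \<Gamma> \<Longrightarrow> \<forall>n. ctx (drop n \<Gamma>)"
  and typing_ctx_drop: "\<Gamma> \<turnstile> t : T \<Longrightarrow> \<forall>n. ctx (drop n \<Gamma>)"
  by (induction rule: ctx_typing.inducts) (auto simp: all_drop_Cons intro: ctx_Nil ctx_Cons)

lemma typing_ctx: "\<Gamma> \<turnstile> t : T \<Longrightarrow> ctx \<Gamma>"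
  using typing_ctx_drop by (metis drop0)

lemma ctx_ConsD: "ctx (A # \<Gamma>) \<Longrightarrow> ctx \<Gamma>"
  using ctx_drop by (metis drop0 drop_Suc_Cons)

lemma ctx_weaken: "ctx \<Gamma> \<Longrightarrow> \<Gamma> = \<Delta> @ \<Gamma>' \<Longrightarrow> \<Gamma>' \<turnstile> A : U i \<Longrightarrow> ctx (lift_ctx \<Delta> @ A # \<Gamma>')"
  and typing_weaken: "\<Gamma> \<turnstile> t : T \<Longrightarrow> \<Gamma> = \<Delta> @ \<Gamma>' \<Longrightarrow> \<Gamma>' \<turnstile> A : U i \<Longrightarrow>
    lift_ctx \<Delta> @ A # \<Gamma>' \<turnstile> lift 1 (length \<Delta>) t : lift 1 (length \<Delta>) T"
proof (induction arbitrary: \<Delta> and \<Delta> rule: ctx_typing.inducts)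
  case ctx_Nil
  then show ?case by (auto intro: ctx_typing.intros)
next
  case (ctx_Cons \<Gamma> B j)
  then show ?case by (cases \<Delta>) (auto intro: ctx_typing.intros)
next
  case (ty_Var \<Gamma> k)
  have c: "ctx (lift_ctx \<Delta> @ A # \<Gamma>')" using ty_Var by auto
  show ?case
  proof (cases "k < length \<Delta>")
    case True
    then obtain e where e: "length \<Delta> = Suc (k + e)" using less_imp_Suc_add by blast
    have "lift_ctx \<Delta> @ A # \<Gamma>' \<turnstile> Var k : lift (Suc k) 0 ((lift_ctx \<Delta> @ A # \<Gamma>') ! k)"
      using c True by (intro ctx_typing.ty_Var) auto
    also have "(lift_ctx \<Delta> @ A # \<Gamma>') ! k = lift 1 (length \<Delta> - Suc k) (\<Delta> ! k)"
      using True by (simp add: nth_append nth_lift_ctx)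
    also have "lift (Suc k) 0 (lift 1 (length \<Delta> - Suc k) (\<Delta> ! k)) = lift 1 (length \<Delta>) (lift (Suc k) 0 (\<Delta> ! k))"
      using lift_lift_comm[of 0 e 1 "Suc k" "\<Delta> ! k"] e by (simp add: add.commute)
    finally show ?thesis using True ty_Var by (simp add: nth_append)
  next
    case False
    have "lift_ctx \<Delta> @ A # \<Gamma>' \<turnstile> Var (Suc k) : lift (Suc (Suc k)) 0 ((lift_ctx \<Delta> @ A # \<Gamma>') ! Suc k)"
      using c False ty_Var by (intro ctx_typing.ty_Var) auto
    also have "(lift_ctx \<Delta> @ A # \<Gamma>') ! Suc k = \<Gamma>' ! (k - length \<Delta>)"
      using False by (simp add: nth_append Suc_diff_le)
    also have "lift (Suc (Suc k)) 0 (\<Gamma>' ! (k - length \<Delta>)) = lift 1 (length \<Delta>) (lift (Suc k) 0 (\<Gamma>' ! (k - length \<Delta>)))"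
      using lift_lift_add[of 0 "length \<Delta>" "Suc k" 1] False by simp
    finally show ?thesis using False ty_Var by (simp add: nth_append)
  qed
next
  case (ty_Pi \<Gamma> B j C)
  from ty_Pi.IH(1)[OF ty_Pi.prems] ty_Pi.IH(2)[of "B # \<Delta>"] ty_Pi.prems
  show ?case by (auto intro!: ctx_typing.ty_Pi)
next
  case (ty_Lam B \<Gamma> b C)
  from ty_Lam.IH[of "B # \<Delta>"] ty_Lam.prems
  show ?case by (auto intro!: ctx_typing.ty_Lam)
next
  case (ty_App \<Gamma> f B C a)
  from ctx_typing.ty_App[of "lift_ctx \<Delta> @ A # \<Gamma>'" "lift 1 (length \<Delta>) f" "lift 1 (length \<Delta>) B"
      "lift 1 (Suc (length \<Delta>)) C" "lift 1 (length \<Delta>) a"] ty_App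
    lift_subst[of 1 "length \<Delta>" 0 a C]
  show ?case by auto
next
  case (ty_conv \<Gamma> a B C j)
  then show ?case by (auto intro: ctx_typing.ty_conv conv_lift)
qed (auto intro: ctx_typing.intros)

lemma weaken_Cons: "\<Gamma> \<turnstile> t : T \<Longrightarrow> ctx (A # \<Gamma>) \<Longrightarrow> A # \<Gamma> \<turnstile> lift 1 0 t : lift 1 0 T"
  using typing_weaken[of \<Gamma> t T "[]"] by (auto elim: ctx.cases)

lemma weaken_append: "\<Gamma> \<turnstile> t : T \<Longrightarrow> ctx (\<Delta> @ \<Gamma>) \<Longrightarrow> \<Delta> @ \<Gamma> \<turnstile> lift (length \<Delta>) 0 t : lift (length \<Delta>) 0 T"
proof (induction \<Delta>)
  case (Cons A \<Delta>)
  then have "\<Delta> @ \<Gamma> \<turnstile> lift (length \<Delta>) 0 t : lift (length \<Delta>) 0 T"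
    using ctx_ConsD[of A "\<Delta> @ \<Gamma>"] by simp
  from weaken_Cons[OF this] Cons.prems show ?case
    by (simp add: lift_lift_add[of 0 0 _ "Suc 0"])
qed simp

lemma ctx_subst: "ctx \<Gamma> \<Longrightarrow> \<Gamma> = \<Delta> @ A # \<Gamma>' \<Longrightarrow> \<Gamma>' \<turnstile> s : A \<Longrightarrow> ctx (subst_ctx s \<Delta> @ \<Gamma>')"
  and typing_subst: "\<Gamma> \<turnstile> t : T \<Longrightarrow> \<Gamma> = \<Delta> @ A # \<Gamma>' \<Longrightarrow> \<Gamma>' \<turnstile> s : A \<Longrightarrow>
    subst_ctx s \<Delta> @ \<Gamma>' \<turnstile> subst (length \<Delta>) s t : subst (length \<Delta>) s T"
proof (induction arbitrary: \<Delta> and \<Delta> rule: ctx_typing.inducts)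
  case (ctx_Cons \<Gamma> B j)
  then show ?case by (cases \<Delta>) (auto intro: ctx_typing.intros typing_ctx)
next
  case (ty_Var \<Gamma> k)
  have c: "ctx (subst_ctx s \<Delta> @ \<Gamma>')" using ty_Var by auto
  consider (lt) "k < length \<Delta>" | (eq) "k = length \<Delta>" | (gt) "k > length \<Delta>" by linarith
  then show ?case
  proof cases
    case lt
    then obtain e where e: "length \<Delta> = Suc (k + e)" using less_imp_Suc_add by blast
    have "subst_ctx s \<Delta> @ \<Gamma>' \<turnstile> Var k : lift (Suc k) 0 ((subst_ctx s \<Delta> @ \<Gamma>') ! k)"
      using c lt by (intro ctx_typing.ty_Var) auto
    also have "(subst_ctx s \<Delta> @ \<Gamma>') ! k = subst (length \<Delta> - Suc k) s (\<Delta> ! k)"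
      using lt by (simp add: nth_append nth_subst_ctx)
    also have "lift (Suc k) 0 (subst (length \<Delta> - Suc k) s (\<Delta> ! k)) = subst (length \<Delta>) s (lift (Suc k) 0 (\<Delta> ! k))"
      using subst_lift_comm[of 0 e "Suc k" s "\<Delta> ! k"] e by (simp add: add.commute)
    finally show ?thesis using lt ty_Var by (simp add: nth_append)
  next
    case eq
    have "subst_ctx s \<Delta> @ \<Gamma>' \<turnstile> lift (length \<Delta>) 0 s : lift (length \<Delta>) 0 A"
      using weaken_append[OF ty_Var.prems(2) c] by simp
    moreover have "subst (length \<Delta>) s (lift (Suc (length \<Delta>)) 0 A) = lift (length \<Delta>) 0 A"
      by (rule subst_lift) auto
    ultimately show ?thesis using eq ty_Var by (simp add: nth_append)
  next
    case gt
    then obtain m where m: "k = Suc m" by (cases k) auto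
    have "subst_ctx s \<Delta> @ \<Gamma>' \<turnstile> Var m : lift (Suc m) 0 ((subst_ctx s \<Delta> @ \<Gamma>') ! m)"
      using c gt m ty_Var by (intro ctx_typing.ty_Var) auto
    moreover have "(subst_ctx s \<Delta> @ \<Gamma>') ! m = \<Gamma> ! k"
      using gt m ty_Var by (simp add: nth_append Suc_diff_le)
    moreover have "subst (length \<Delta>) s (lift (Suc (Suc m)) 0 (\<Gamma> ! k)) = lift (Suc m) 0 (\<Gamma> ! k)"
      by (rule subst_lift) (use gt m in auto)
    ultimately show ?thesis using gt m by simp
  qed
next
  case (ty_Pi \<Gamma> B j C)
  from ty_Pi.IH(1)[OF ty_Pi.prems] ty_Pi.IH(2)[of "B # \<Delta>"] ty_Pi.prems
  show ?case by (auto intro!: ctx_typing.ty_Pi)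
next
  case (ty_Lam B \<Gamma> b C)
  from ty_Lam.IH[of "B # \<Delta>"] ty_Lam.prems
  show ?case by (auto intro!: ctx_typing.ty_Lam)
next
  case (ty_App \<Gamma> f B C a)
  from ctx_typing.ty_App[of "subst_ctx s \<Delta> @ \<Gamma>'" "subst (length \<Delta>) s f" "subst (length \<Delta>) s B"
      "subst (Suc (length \<Delta>)) s C" "subst (length \<Delta>) s a"] ty_App
    subst_subst[of 0 "length \<Delta>" s a C]
  show ?case by auto
next
  case (ty_conv \<Gamma> a B C j)
  then show ?case by (auto intro: ctx_typing.ty_conv conv_subst)
qed (auto intro: ctx_typing.intros)

text \<open>Inversion of the formation rule is an induction on the derivation, because cumulativity and conversion change
only the type of \<open>Pi A B\<close>.\<close>

lemma Pi_formation: "\<Gamma> \<turnstile> Pi A B : T \<Longrightarrow> \<exists>i. \<Gamma> \<turnstile> A : U i \<and> A # \<Gamma> \<turnstile> B : U i"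
  by (induction \<Gamma> "Pi A B" T rule: ctx_typing.inducts(2)[where ?P1.0 = "\<lambda>_. True"]) auto

lemma cumul_le: "\<Gamma> \<turnstile> A : U i \<Longrightarrow> i \<le> j \<Longrightarrow> \<Gamma> \<turnstile> A : U j"
  by (rotate_tac, induction rule: dec_induct) (auto intro: ty_cumul)

lemma codomain_subst:
  assumes "\<Gamma> \<turnstile> Pi A B : U i" "\<Gamma> \<turnstile> a : A"
  shows "\<exists>j. \<Gamma> \<turnstile> subst 0 a B : U j"
proof -
  obtain j where "A # \<Gamma> \<turnstile> B : U j" using Pi_formation[OF assms(1)] by blast
  from typing_subst[OF this, of "[]"] assms(2) show ?thesis by auto
qed

section \<open>A type checker\<close>

definition apps :: "tm \<Rightarrow> tm list \<Rightarrow> tm" where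
  "apps t as = foldl App t as"

lemma apps_simps [simp]: "apps t [] = t" "apps t (a # as) = apps (t \<degree> a) as"
  by (simp_all add: apps_def)

text \<open>The computation rules fire when the principal argument is a point constructor. The views below recognise such a
term; \<open>Some None\<close> stands for zero and \<open>Some (Some n)\<close> for the successor of \<open>n\<close>.\<close>

fun nat_con :: "const \<Rightarrow> tm list \<Rightarrow> tm option option" where
  "nat_con CZero [] = Some None"
| "nat_con CSucc [n] = Some (Some n)"
| "nat_con c as = None"

fun nat_view :: "tm \<Rightarrow> tm list \<Rightarrow> tm option option" where
  "nat_view (f \<degree> a) as = nat_view f (a # as)"
| "nat_view (Con c) as = nat_con c as"
| "nat_view t as = None"

fun refl_con :: "const \<Rightarrow> tm list \<Rightarrow> (nat \<times> tm \<times> tm) option" where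
  "refl_con (CRefl i) [A, x] = Some (i, A, x)"
| "refl_con c as = None"

fun refl_view :: "tm \<Rightarrow> tm list \<Rightarrow> (nat \<times> tm \<times> tm) option" where
  "refl_view (f \<degree> a) as = refl_view f (a # as)"
| "refl_view (Con c) as = refl_con c as"
| "refl_view t as = None"

fun sin_con :: "const \<Rightarrow> tm list \<Rightarrow> (nat \<times> tm \<times> tm) option" where
  "sin_con (CSIn i) [A, x] = Some (i, A, x)"
| "sin_con c as = None"

fun sin_view :: "tm \<Rightarrow> tm list \<Rightarrow> (nat \<times> tm \<times> tm) option" where
  "sin_view (f \<degree> a) as = sin_view f (a # as)"
| "sin_view (Con c) as = sin_con c as"
| "sin_view t as = None"

fun pair_con :: "const \<Rightarrow> tm list \<Rightarrow> (nat \<times> tm \<times> tm \<times> tm \<times> tm) option" where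
  "pair_con (CPair i) [A, B, a, b] = Some (i, A, B, a, b)"
| "pair_con c as = None"

fun pair_view :: "tm \<Rightarrow> tm list \<Rightarrow> (nat \<times> tm \<times> tm \<times> tm \<times> tm) option" where
  "pair_view (f \<degree> a) as = pair_view f (a # as)"
| "pair_view (Con c) as = pair_con c as"
| "pair_view t as = None"

text \<open>The steps below are parametrised by reduction \<open>w\<close> and comparison \<open>cv\<close>, which will be the same functions with less fuel.\<close>

type_synonym reducer = "tm \<Rightarrow> tm list \<Rightarrow> tm"
type_synonym comparer = "tm \<Rightarrow> tm \<Rightarrow> bool"

fun nat_redex :: "reducer \<Rightarrow> nat \<Rightarrow> tm \<Rightarrow> tm \<Rightarrow> tm \<Rightarrow> tm \<Rightarrow> tm list \<Rightarrow> tm option option \<Rightarrow> tm" where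
  "nat_redex w j C z s n as None = apps (Con (CNatInd j) \<degree> C \<degree> z \<degree> s \<degree> n) as"
| "nat_redex w j C z s n as (Some None) = w z as"
| "nat_redex w j C z s n as (Some (Some k)) = w s (k # (Con (CNatInd j) \<degree> C \<degree> z \<degree> s \<degree> k) # as)"

text \<open>The computation rules for pairs, paths and set truncations are not left-linear: the parameters of the constructor must
agree with those of the eliminator. As the reduction is untyped this is not automatic, so such a rule fires only after
a comparison of the parameters.\<close>

fun fire :: "reducer \<Rightarrow> tm \<Rightarrow> tm list \<Rightarrow> tm \<Rightarrow> tm list \<Rightarrow> bool \<Rightarrow> tm" where
  "fire w t as s bs True = w t as"
| "fire w t as s bs False = apps s bs"

fun J_redex :: "reducer \<Rightarrow> comparer \<Rightarrow> nat \<Rightarrow> nat \<Rightarrow> tm \<Rightarrow> tm \<Rightarrow> tm \<Rightarrow> tm \<Rightarrow> tm \<Rightarrow> tm \<Rightarrow> tm list \<Rightarrow> (nat \<times> tm \<times> tm) option \<Rightarrow> tm" where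
  "J_redex w cv i j A C e x y p as None = apps (Con (CJ i j) \<degree> A \<degree> C \<degree> e \<degree> x \<degree> y \<degree> p) as"
| "J_redex w cv i j A C e x y p as (Some (k, A', a)) =
     fire w e (a # as) (Con (CJ i j) \<degree> A \<degree> C \<degree> e \<degree> x \<degree> y \<degree> p) as (k = i \<and> cv A A' \<and> cv x a \<and> cv y a)"

fun pair_redex :: "reducer \<Rightarrow> comparer \<Rightarrow> nat \<Rightarrow> nat \<Rightarrow> tm \<Rightarrow> tm \<Rightarrow> tm \<Rightarrow> tm \<Rightarrow> tm \<Rightarrow> tm list \<Rightarrow> (nat \<times> tm \<times> tm \<times> tm \<times> tm) option \<Rightarrow> tm" where
  "pair_redex w cv i j A B C g p as None = apps (Con (CSigInd i j) \<degree> A \<degree> B \<degree> C \<degree> g \<degree> p) as"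
| "pair_redex w cv i j A B C g p as (Some (k, A', B', a, b)) =
     fire w g (a # b # as) (Con (CSigInd i j) \<degree> A \<degree> B \<degree> C \<degree> g \<degree> p) as (k = i \<and> cv A A' \<and> cv B B')"

fun sin_redex :: "reducer \<Rightarrow> comparer \<Rightarrow> nat \<Rightarrow> nat \<Rightarrow> tm \<Rightarrow> tm \<Rightarrow> tm \<Rightarrow> tm \<Rightarrow> tm \<Rightarrow> tm list \<Rightarrow> (nat \<times> tm \<times> tm) option \<Rightarrow> tm" where
  "sin_redex w cv i j A C h g x as None = apps (Con (CSInd i j) \<degree> A \<degree> C \<degree> h \<degree> g \<degree> x) as"
| "sin_redex w cv i j A C h g x as (Some (k, A', a)) =
     fire w g (a # as) (Con (CSInd i j) \<degree> A \<degree> C \<degree> h \<degree> g \<degree> x) as (k = i \<and> cv A A')"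

fun whnf_con :: "reducer \<Rightarrow> comparer \<Rightarrow> const \<Rightarrow> tm list \<Rightarrow> tm" where
  "whnf_con w cv (CNatInd j) (C # z # s # n # as) = nat_redex w j C z s n as (nat_view (w n []) [])"
| "whnf_con w cv (CSigInd i j) (A # B # C # g # p # as) = pair_redex w cv i j A B C g p as (pair_view (w p []) [])"
| "whnf_con w cv (CJ i j) (A # C # e # x # y # p # as) = J_redex w cv i j A C e x y p as (refl_view (w p []) [])"
| "whnf_con w cv (CSInd i j) (A # C # h # g # x # as) = sin_redex w cv i j A C h g x as (sin_view (w x []) [])"
| "whnf_con w cv c as = apps (Con c) as"

fun whnf_step :: "reducer \<Rightarrow> comparer \<Rightarrow> tm \<Rightarrow> tm list \<Rightarrow> tm" where
  "whnf_step w cv (f \<degree> a) as = w f (a # as)"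
| "whnf_step w cv (Lam A b) (a # as) = w (subst 0 a b) as"
| "whnf_step w cv (Con c) as = whnf_con w cv c as"
| "whnf_step w cv t as = apps t as"

fun spine :: "tm \<Rightarrow> tm list \<Rightarrow> tm \<times> tm list" where
  "spine (f \<degree> a) as = spine f (a # as)"
| "spine t as = (t, as)"

text \<open>Weak head normal forms are compared by their heads and then argument by argument.\<close>

fun conv_list :: "comparer \<Rightarrow> tm list \<Rightarrow> tm list \<Rightarrow> bool" and
    conv_next :: "comparer \<Rightarrow> tm list \<Rightarrow> tm list \<Rightarrow> bool \<Rightarrow> bool" where
  "conv_list cv [] [] = True"
| "conv_list cv (a # as) (b # bs) = conv_next cv as bs (cv a b)"
| "conv_list cv as bs = False"
| "conv_next cv as bs True = conv_list cv as bs"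
| "conv_next cv as bs False = False"

fun conv_whnf :: "comparer \<Rightarrow> tm \<times> tm list \<Rightarrow> tm \<times> tm list \<Rightarrow> bool" where
  "conv_whnf cv (Pi A B, as) (Pi A' B', bs) = conv_list cv (A # B # as) (A' # B' # bs)"
| "conv_whnf cv (Lam A b, as) (Lam A' b', bs) = conv_list cv (A # b # as) (A' # b' # bs)"
| "conv_whnf cv (Var x, as) (Var y, bs) = conv_next cv as bs (x = y)"
| "conv_whnf cv (U x, as) (U y, bs) = conv_next cv as bs (x = y)"
| "conv_whnf cv (Con x, as) (Con y, bs) = conv_next cv as bs (x = y)"
| "conv_whnf cv s t = False"

fun conv_step :: "reducer \<Rightarrow> comparer \<Rightarrow> tm \<Rightarrow> tm \<Rightarrow> bool \<Rightarrow> bool" where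
  "conv_step w cv s t True = True"
| "conv_step w cv s t False = conv_whnf cv (spine (w s []) []) (spine (w t []) [])"

text \<open>Reduction of a term applied to a stack of arguments, and comparison of terms by reduction. Untyped reduction need
not terminate, hence the fuel. Before anything is reduced the two terms are tested for syntactic equality.\<close>

fun whnf :: "nat \<Rightarrow> tm \<Rightarrow> tm list \<Rightarrow> tm" and conv_ck :: "nat \<Rightarrow> tm \<Rightarrow> tm \<Rightarrow> bool" where
  "whnf 0 t as = apps t as"
| "whnf (Suc n) t as = whnf_step (whnf n) (conv_ck n) t as"
| "conv_ck 0 s t = False"
| "conv_ck (Suc n) s t = conv_step (whnf n) (conv_ck n) s t (s = t)"

type_synonym checker = "tm list \<Rightarrow> tm option \<Rightarrow> tm \<Rightarrow> tm option"

fun univ_view :: "tm \<Rightarrow> nat option" where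
  "univ_view (U i) = Some i"
| "univ_view t = None"

fun level_of :: "reducer \<Rightarrow> tm option \<Rightarrow> nat option" where
  "level_of w None = None"
| "level_of w (Some T) = univ_view (w T [])"

fun if_level :: "nat option \<Rightarrow> 'a \<Rightarrow> 'a option" where
  "if_level None x = None"
| "if_level (Some i) x = Some x"

text \<open>The type of a function may be a term that reduces to a \<open>Pi\<close>. The reduct is then type checked anew. This takes the
place of subject reduction, which is doubtful for untyped rules that are not left-linear.\<close>

fun valid_Pi :: "reducer \<Rightarrow> checker \<Rightarrow> tm list \<Rightarrow> tm \<Rightarrow> (tm \<times> tm) option" where
  "valid_Pi w ck \<Gamma> (Pi A B) = if_level (level_of w (ck \<Gamma> None (Pi A B))) (A, B)"
| "valid_Pi w ck \<Gamma> t = None"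

fun as_Pi :: "reducer \<Rightarrow> checker \<Rightarrow> tm list \<Rightarrow> tm \<Rightarrow> (tm \<times> tm) option" where
  "as_Pi w ck \<Gamma> (Pi A B) = Some (A, B)"
| "as_Pi w ck \<Gamma> T = valid_Pi w ck \<Gamma> (w T [])"

fun as_Pi_opt :: "reducer \<Rightarrow> checker \<Rightarrow> tm list \<Rightarrow> tm option \<Rightarrow> (tm \<times> tm) option" where
  "as_Pi_opt w ck \<Gamma> None = None"
| "as_Pi_opt w ck \<Gamma> (Some T) = as_Pi w ck \<Gamma> T"

fun app_result :: "tm \<Rightarrow> tm \<Rightarrow> tm option \<Rightarrow> tm option" where
  "app_result a B None = None"
| "app_result a B (Some T) = Some (subst 0 a B)"

fun synth_App :: "checker \<Rightarrow> tm list \<Rightarrow> tm \<Rightarrow> (tm \<times> tm) option \<Rightarrow> tm option" where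
  "synth_App ck \<Gamma> a None = None"
| "synth_App ck \<Gamma> a (Some (A, B)) = app_result a B (ck \<Gamma> (Some A) a)"

fun synth_Pi2 :: "nat \<Rightarrow> nat option \<Rightarrow> tm option" where
  "synth_Pi2 i None = None"
| "synth_Pi2 i (Some j) = Some (U (max i j))"

fun synth_Pi :: "reducer \<Rightarrow> checker \<Rightarrow> tm list \<Rightarrow> tm \<Rightarrow> tm \<Rightarrow> nat option \<Rightarrow> tm option" where
  "synth_Pi w ck \<Gamma> A B None = None"
| "synth_Pi w ck \<Gamma> A B (Some i) = synth_Pi2 i (level_of w (ck (A # \<Gamma>) None B))"

fun synth_Lam2 :: "tm \<Rightarrow> tm option \<Rightarrow> tm option" where
  "synth_Lam2 A None = None"
| "synth_Lam2 A (Some B) = Some (Pi A B)"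

fun synth_Lam :: "checker \<Rightarrow> tm list \<Rightarrow> tm \<Rightarrow> tm \<Rightarrow> nat option \<Rightarrow> tm option" where
  "synth_Lam ck \<Gamma> A b None = None"
| "synth_Lam ck \<Gamma> A b (Some i) = synth_Lam2 A (ck (A # \<Gamma>) None b)"

fun synth_Var :: "nat \<Rightarrow> nat \<Rightarrow> tm list \<Rightarrow> tm option" where
  "synth_Var k n [] = None"
| "synth_Var k 0 (A # \<Gamma>) = Some (lift k 0 A)"
| "synth_Var k (Suc n) (A # \<Gamma>) = synth_Var k n \<Gamma>"

fun synth_Con :: "const \<Rightarrow> bool \<Rightarrow> tm option" where
  "synth_Con c True = Some (ctype c)"
| "synth_Con c False = None"

fun synth_step :: "(const \<Rightarrow> bool) \<Rightarrow> reducer \<Rightarrow> checker \<Rightarrow> tm list \<Rightarrow> tm \<Rightarrow> tm option" where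
  "synth_step S w ck \<Gamma> (Var k) = synth_Var (Suc k) k \<Gamma>"
| "synth_step S w ck \<Gamma> (U i) = Some (U (Suc i))"
| "synth_step S w ck \<Gamma> (Con c) = synth_Con c (S c)"
| "synth_step S w ck \<Gamma> (Pi A B) = synth_Pi w ck \<Gamma> A B (level_of w (ck \<Gamma> None A))"
| "synth_step S w ck \<Gamma> (Lam A b) = synth_Lam ck \<Gamma> A b (level_of w (ck \<Gamma> None A))"
| "synth_step S w ck \<Gamma> (f \<degree> a) = synth_App ck \<Gamma> a (as_Pi_opt w ck \<Gamma> (ck \<Gamma> None f))"

fun guard :: "bool \<Rightarrow> 'a \<Rightarrow> 'a option" where
  "guard True x = Some x"
| "guard False x = None"

fun sub_univ :: "tm \<Rightarrow> tm \<Rightarrow> bool" where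
  "sub_univ (U i) (U j) = (i \<le> j)"
| "sub_univ S T = False"

fun check_sub2 :: "reducer \<Rightarrow> tm \<Rightarrow> tm \<Rightarrow> bool \<Rightarrow> tm option" where
  "check_sub2 w S T True = Some T"
| "check_sub2 w S T False = guard (sub_univ (w S []) (w T [])) T"

fun check_sub :: "reducer \<Rightarrow> comparer \<Rightarrow> tm \<Rightarrow> tm option \<Rightarrow> tm option" where
  "check_sub w cv T None = None"
| "check_sub w cv T (Some S) = check_sub2 w S T (cv S T)"

text \<open>An abstraction whose domain is only convertible to the expected one is checked in the context of its own domain,
where the expected codomain has to be validated again.\<close>

fun check_Lam3 :: "checker \<Rightarrow> tm list \<Rightarrow> tm \<Rightarrow> tm \<Rightarrow> tm \<Rightarrow> bool \<Rightarrow> nat option \<Rightarrow> nat option \<Rightarrow> tm option" where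
  "check_Lam3 ck \<Gamma> A b B True (Some i) (Some j) = ck (A # \<Gamma>) (Some B) b"
| "check_Lam3 ck \<Gamma> A b B u v v' = None"

fun check_Lam2 :: "reducer \<Rightarrow> comparer \<Rightarrow> checker \<Rightarrow> tm list \<Rightarrow> tm \<Rightarrow> tm \<Rightarrow> tm \<Rightarrow> tm \<Rightarrow> bool \<Rightarrow> tm option" where
  "check_Lam2 w cv ck \<Gamma> A b A' B True = ck (A # \<Gamma>) (Some B) b"
| "check_Lam2 w cv ck \<Gamma> A b A' B False =
     check_Lam3 ck \<Gamma> A b B (cv A A') (level_of w (ck \<Gamma> None A)) (level_of w (ck (A # \<Gamma>) None B))"

fun check_Lam :: "reducer \<Rightarrow> comparer \<Rightarrow> checker \<Rightarrow> tm list \<Rightarrow> tm \<Rightarrow> tm \<Rightarrow> (tm \<times> tm) option \<Rightarrow> tm option" where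
  "check_Lam w cv ck \<Gamma> A b None = None"
| "check_Lam w cv ck \<Gamma> A b (Some (A', B)) = check_Lam2 w cv ck \<Gamma> A b A' B (A = A')"

fun check_step :: "reducer \<Rightarrow> comparer \<Rightarrow> checker \<Rightarrow> tm list \<Rightarrow> tm \<Rightarrow> tm \<Rightarrow> tm option" where
  "check_step w cv ck \<Gamma> T (Lam A b) = check_Lam w cv ck \<Gamma> A b (as_Pi w ck \<Gamma> T)"
| "check_step w cv ck \<Gamma> T t = check_sub w cv T (ck \<Gamma> None t)"

text \<open>The table \<open>D\<close> gives the types of some closed terms that were checked before, so that their repeated occurrences
need not be checked again.\<close>

fun synth_known :: "tm option \<Rightarrow> (const \<Rightarrow> bool) \<Rightarrow> reducer \<Rightarrow> checker \<Rightarrow> tm list \<Rightarrow> tm \<Rightarrow> tm option" where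
  "synth_known (Some T) S w ck \<Gamma> t = Some T"
| "synth_known None S w ck \<Gamma> t = synth_step S w ck \<Gamma> t"

fun check_known :: "tm option \<Rightarrow> reducer \<Rightarrow> comparer \<Rightarrow> checker \<Rightarrow> tm list \<Rightarrow> tm \<Rightarrow> tm \<Rightarrow> tm option" where
  "check_known (Some T') w cv ck \<Gamma> T t = check_sub w cv T (Some T')"
| "check_known None w cv ck \<Gamma> T t = check_step w cv ck \<Gamma> T t"

text \<open>The mode \<open>None\<close> asks for a type of the term; the mode \<open>Some T\<close> checks the term against \<open>T\<close>, and then any result other
than \<open>None\<close> means success. The predicate \<open>S\<close> selects the constants that may occur.\<close>

fun tc :: "(const \<Rightarrow> bool) \<Rightarrow> (tm \<Rightarrow> tm option) \<Rightarrow> nat \<Rightarrow> checker" where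
  "tc S D 0 \<Gamma> m t = None"
| "tc S D (Suc n) \<Gamma> None t = synth_known (D t) S (whnf n) (tc S D n) \<Gamma> t"
| "tc S D (Suc n) \<Gamma> (Some T) t = check_known (D t) (whnf n) (conv_ck n) (tc S D n) \<Gamma> T t"

definition accepts :: "(const \<Rightarrow> bool) \<Rightarrow> (tm \<Rightarrow> tm option) \<Rightarrow> nat \<Rightarrow> tm \<Rightarrow> tm \<Rightarrow> bool" where
  "accepts S D n t T = (level_of (whnf n) (tc S D n [] None T) \<noteq> None \<and> tc S D n [] (Some T) t \<noteq> None)"

section \<open>Soundness of the type checker\<close>

declare conv_refl [simp, intro]

lemma conv_apps: "s \<equiv>\<^sub>J t \<Longrightarrow> apps s as \<equiv>\<^sub>J apps t as"
  by (induction as arbitrary: s t) (auto intro: conv_App)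

lemma nat_con_sound: "nat_con c as = Some v \<Longrightarrow>
    apps (Con c) as = (case v of None \<Rightarrow> Con CZero | Some n \<Rightarrow> Con CSucc \<degree> n)"
  by (cases "(c, as)" rule: nat_con.cases) auto

lemma nat_view_sound: "nat_view t as = Some v \<Longrightarrow>
    apps t as = (case v of None \<Rightarrow> Con CZero | Some n \<Rightarrow> Con CSucc \<degree> n)"
  by (induction t as rule: nat_view.induct) (auto simp: nat_con_sound)

lemma refl_con_sound: "refl_con c as = Some (i, A, x) \<Longrightarrow> apps (Con c) as = Con (CRefl i) \<degree> A \<degree> x"
  by (cases "(c, as)" rule: refl_con.cases) auto

lemma refl_view_sound: "refl_view t as = Some (i, A, x) \<Longrightarrow> apps t as = Con (CRefl i) \<degree> A \<degree> x"
  by (induction t as rule: refl_view.induct) (auto simp: refl_con_sound)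

lemma sin_con_sound: "sin_con c as = Some (i, A, x) \<Longrightarrow> apps (Con c) as = Con (CSIn i) \<degree> A \<degree> x"
  by (cases "(c, as)" rule: sin_con.cases) auto

lemma sin_view_sound: "sin_view t as = Some (i, A, x) \<Longrightarrow> apps t as = Con (CSIn i) \<degree> A \<degree> x"
  by (induction t as rule: sin_view.induct) (auto simp: sin_con_sound)

lemma pair_con_sound: "pair_con c as = Some (i, A, B, a, b) \<Longrightarrow>
    apps (Con c) as = Con (CPair i) \<degree> A \<degree> B \<degree> a \<degree> b"
  by (cases "(c, as)" rule: pair_con.cases) auto

lemma pair_view_sound: "pair_view t as = Some (i, A, B, a, b) \<Longrightarrow>
    apps t as = Con (CPair i) \<degree> A \<degree> B \<degree> a \<degree> b"
  by (induction t as rule: pair_view.induct) (auto simp: pair_con_sound)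

text \<open>The fuel may run out before a normal form is reached, so soundness of a reducer only means that judgmental equality is
preserved.\<close>

definition sound_red :: "reducer \<Rightarrow> bool" where
  "sound_red w \<longleftrightarrow> (\<forall>t as. apps t as \<equiv>\<^sub>J w t as)"

definition sound_cmp :: "comparer \<Rightarrow> bool" where
  "sound_cmp cv \<longleftrightarrow> (\<forall>s t. cv s t \<longrightarrow> s \<equiv>\<^sub>J t)"

lemma sound_redD: "sound_red w \<Longrightarrow> apps t as \<equiv>\<^sub>J w t as"
  by (simp add: sound_red_def)

lemma sound_red_Nil: "sound_red w \<Longrightarrow> t \<equiv>\<^sub>J w t []"
  using sound_redD[of w t "[]"] by simp

lemma sound_cmpD: "sound_cmp cv \<Longrightarrow> cv s t \<Longrightarrow> s \<equiv>\<^sub>J t"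
  by (simp add: sound_cmp_def)

lemma fire_sound:
  assumes "sound_red w" "b \<Longrightarrow> apps s bs \<equiv>\<^sub>J apps t as"
  shows "apps s bs \<equiv>\<^sub>J fire w t as s bs b"
  using assms by (cases b) (auto intro: conv_trans sound_redD)

lemma nat_redex_sound:
  assumes w: "sound_red w"
  shows "apps (Con (CNatInd j) \<degree> C \<degree> z \<degree> s \<degree> n) as \<equiv>\<^sub>J nat_redex w j C z s n as (nat_view (w n []) [])"
proof (cases "nat_view (w n []) []")
  case (Some v)
  have n: "n \<equiv>\<^sub>J (case v of None \<Rightarrow> Con CZero | Some n \<Rightarrow> Con CSucc \<degree> n)"
    using nat_view_sound[OF Some] sound_red_Nil[OF w, of n] by simp
  show ?thesis
  proof (cases v)
    case None
    have "Con (CNatInd j) \<degree> C \<degree> z \<degree> s \<degree> n \<equiv>\<^sub>J z"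
      using n None by (auto intro: conv_trans[OF conv_App iota_zero])
    then show ?thesis using Some None
      by (auto intro: conv_trans[OF conv_apps sound_redD[OF w]])
  next
    fix k assume k: "v = Some k"
    have "Con (CNatInd j) \<degree> C \<degree> z \<degree> s \<degree> n \<equiv>\<^sub>J s \<degree> k \<degree> (Con (CNatInd j) \<degree> C \<degree> z \<degree> s \<degree> k)"
      using n k by (auto intro: conv_trans[OF conv_App iota_succ])
    from conv_apps[OF this, of as] show ?thesis using Some k
      by (auto intro: conv_trans sound_redD[OF w, of s "k # _ # as", simplified])
  qed
qed simp

lemma J_redex_sound:
  assumes w: "sound_red w" and cv: "sound_cmp cv"
  shows "apps (Con (CJ i j) \<degree> A \<degree> C \<degree> e \<degree> x \<degree> y \<degree> p) as
    \<equiv>\<^sub>J J_redex w cv i j A C e x y p as (refl_view (w p []) [])"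
proof (cases "refl_view (w p []) []")
  case (Some v)
  obtain k A' a where v: "v = (k, A', a)" by (cases v) auto
  have p: "p \<equiv>\<^sub>J Con (CRefl k) \<degree> A' \<degree> a"
    using refl_view_sound Some v sound_red_Nil[OF w, of p] by fastforce
  have "apps (Con (CJ i j) \<degree> A \<degree> C \<degree> e \<degree> x \<degree> y \<degree> p) as \<equiv>\<^sub>J apps e (a # as)"
    if h: "k = i \<and> cv A A' \<and> cv x a \<and> cv y a"
  proof -
    have "Con (CJ i j) \<degree> A \<degree> C \<degree> e \<degree> x \<degree> y \<degree> p
        \<equiv>\<^sub>J Con (CJ i j) \<degree> A' \<degree> C \<degree> e \<degree> a \<degree> a \<degree> (Con (CRefl i) \<degree> A' \<degree> a)"
      using h p sound_cmpD[OF cv] by (intro conv_App) auto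
    from conv_trans[OF this iota_refl] show ?thesis by (simp add: conv_apps)
  qed
  then show ?thesis using Some v by (auto intro: fire_sound[OF w])
qed simp

lemma pair_redex_sound:
  assumes w: "sound_red w" and cv: "sound_cmp cv"
  shows "apps (Con (CSigInd i j) \<degree> A \<degree> B \<degree> C \<degree> g \<degree> p) as
    \<equiv>\<^sub>J pair_redex w cv i j A B C g p as (pair_view (w p []) [])"
proof (cases "pair_view (w p []) []")
  case (Some v)
  obtain k A' B' a b where v: "v = (k, A', B', a, b)" by (cases v) auto
  have p: "p \<equiv>\<^sub>J Con (CPair k) \<degree> A' \<degree> B' \<degree> a \<degree> b"
    using pair_view_sound Some v sound_red_Nil[OF w, of p] by fastforce
  have "apps (Con (CSigInd i j) \<degree> A \<degree> B \<degree> C \<degree> g \<degree> p) as \<equiv>\<^sub>J apps g (a # b # as)"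
    if h: "k = i \<and> cv A A' \<and> cv B B'"
  proof -
    have "Con (CSigInd i j) \<degree> A \<degree> B \<degree> C \<degree> g \<degree> p
        \<equiv>\<^sub>J Con (CSigInd i j) \<degree> A' \<degree> B' \<degree> C \<degree> g \<degree> (Con (CPair i) \<degree> A' \<degree> B' \<degree> a \<degree> b)"
      using h p sound_cmpD[OF cv] by (intro conv_App) auto
    from conv_trans[OF this iota_pair] show ?thesis by (simp add: conv_apps)
  qed
  then show ?thesis using Some v by (auto intro: fire_sound[OF w])
qed simp

lemma sin_redex_sound:
  assumes w: "sound_red w" and cv: "sound_cmp cv"
  shows "apps (Con (CSInd i j) \<degree> A \<degree> C \<degree> h \<degree> g \<degree> x) as
    \<equiv>\<^sub>J sin_redex w cv i j A C h g x as (sin_view (w x []) [])"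
proof (cases "sin_view (w x []) []")
  case (Some v)
  obtain k A' a where v: "v = (k, A', a)" by (cases v) auto
  have x: "x \<equiv>\<^sub>J Con (CSIn k) \<degree> A' \<degree> a"
    using sin_view_sound Some v sound_red_Nil[OF w, of x] by fastforce
  have "apps (Con (CSInd i j) \<degree> A \<degree> C \<degree> h \<degree> g \<degree> x) as \<equiv>\<^sub>J apps g (a # as)"
    if c: "k = i \<and> cv A A'"
  proof -
    have "Con (CSInd i j) \<degree> A \<degree> C \<degree> h \<degree> g \<degree> x
        \<equiv>\<^sub>J Con (CSInd i j) \<degree> A' \<degree> C \<degree> h \<degree> g \<degree> (Con (CSIn i) \<degree> A' \<degree> a)"
      using c x sound_cmpD[OF cv] by (intro conv_App) auto
    from conv_trans[OF this iota_strunc] show ?thesis by (simp add: conv_apps)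
  qed
  then show ?thesis using Some v by (auto intro: fire_sound[OF w])
qed simp

lemma whnf_con_sound:
  assumes "sound_red w" "sound_cmp cv"
  shows "apps (Con c) as \<equiv>\<^sub>J whnf_con w cv c as"
  using nat_redex_sound[OF assms(1)] J_redex_sound[OF assms] pair_redex_sound[OF assms] sin_redex_sound[OF assms]
  by (cases "(w, cv, c, as)" rule: whnf_con.cases) auto

lemma whnf_step_sound:
  assumes "sound_red w" "sound_cmp cv"
  shows "apps t as \<equiv>\<^sub>J whnf_step w cv t as"
proof (cases "(w, cv, t, as)" rule: whnf_step.cases)
  case (1 w' cv' f a as')
  then show ?thesis using sound_redD[OF assms(1), of f "a # as'"] by simp
next
  case (2 w' cv' A b a as')
  have "apps (Lam A b \<degree> a) as' \<equiv>\<^sub>J apps (subst 0 a b) as'"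
    by (rule conv_apps, rule beta)
  from conv_trans[OF this sound_redD[OF assms(1)]] show ?thesis using 2 by simp
qed (use whnf_con_sound[OF assms] in auto)

lemma spine_apps: "spine t as = (h, bs) \<Longrightarrow> apps h bs = apps t as"
  by (induction t as rule: spine.induct) auto

lemma conv_list_sound:
  assumes "sound_cmp cv"
  shows "conv_list cv as bs \<Longrightarrow> h \<equiv>\<^sub>J h' \<Longrightarrow> apps h as \<equiv>\<^sub>J apps h' bs"
    and "conv_next cv as bs q \<Longrightarrow> h \<equiv>\<^sub>J h' \<Longrightarrow> q \<and> apps h as \<equiv>\<^sub>J apps h' bs"
  using assms
proof (induction cv as bs and cv as bs q arbitrary: h h' and h h' rule: conv_list_conv_next.induct)
  case (2 cv a as b bs)
  have "cv a b" using 2(2) by (cases "cv a b") auto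
  with 2 show ?case using conv_App[OF 2(3) sound_cmpD[of cv a b]] by auto
qed auto

lemma conv_list_Cons: "conv_list cv (a # as) (b # bs) \<Longrightarrow> cv a b \<and> conv_list cv as bs"
  by (cases "cv a b") auto

lemma conv_next_iff: "conv_next cv as bs q \<longleftrightarrow> q \<and> conv_list cv as bs"
  by (cases q) auto

lemma conv_whnf_sound:
  assumes cv: "sound_cmp cv" and "conv_whnf cv (h, as) (h', bs)"
  shows "apps h as \<equiv>\<^sub>J apps h' bs"
proof -
  have "h \<equiv>\<^sub>J h' \<and> conv_list cv as bs"
    using assms(2) sound_cmpD[OF cv]
    by (cases h; cases h') (auto simp: conv_next_iff simp del: conv_list.simps dest!: conv_list_Cons intro: conv_Pi conv_Lam)
  then show ?thesis using conv_list_sound(1)[OF cv] by blast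
qed

lemma conv_step_sound:
  assumes w: "sound_red w" and cv: "sound_cmp cv" and "conv_step w cv s t (s = t)"
  shows "s \<equiv>\<^sub>J t"
proof (cases "s = t")
  case False
  obtain h as h' bs where e: "spine (w s []) [] = (h, as)" "spine (w t []) [] = (h', bs)"
    by (meson surj_pair)
  have "w s [] \<equiv>\<^sub>J w t []"
    using conv_whnf_sound[OF cv, of h as h' bs] assms(3) False e e[THEN spine_apps] by simp
  then show ?thesis using sound_red_Nil[OF w] conv_trans conv_sym by metis
qed simp

lemma reduction_sound: "sound_red (whnf n)" "sound_cmp (conv_ck n)"
proof (induction n)
  case 0
  show "sound_red (whnf 0)" "sound_cmp (conv_ck 0)" by (auto simp: sound_red_def sound_cmp_def)
next
  case (Suc n)
  show "sound_red (whnf (Suc n))"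
    using whnf_step_sound[OF Suc] by (auto simp: sound_red_def)
  show "sound_cmp (conv_ck (Suc n))"
    using conv_step_sound[OF Suc] by (auto simp: sound_cmp_def)
qed

definition valid :: "tm list \<Rightarrow> tm \<Rightarrow> bool" where
  "valid \<Gamma> T \<longleftrightarrow> (\<exists>k. \<Gamma> \<turnstile> T : U k)"

text \<open>Synthesis also guarantees that the synthesised type is a type. With this invariant the rules that need it as a
premise, conversion above all, can be applied without an induction over derivations.\<close>

definition sound_tc :: "checker \<Rightarrow> bool" where
  "sound_tc ck \<longleftrightarrow> (\<forall>\<Gamma> t T. ctx \<Gamma> \<longrightarrow>
     (ck \<Gamma> None t = Some T \<longrightarrow> \<Gamma> \<turnstile> t : T \<and> valid \<Gamma> T) \<and>
     (\<forall>T'. valid \<Gamma> T' \<longrightarrow> ck \<Gamma> (Some T') t = Some T \<longrightarrow> \<Gamma> \<turnstile> t : T'))"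

lemma sound_synth: "sound_tc ck \<Longrightarrow> ctx \<Gamma> \<Longrightarrow> ck \<Gamma> None t = Some T \<Longrightarrow> \<Gamma> \<turnstile> t : T \<and> valid \<Gamma> T"
  by (auto simp: sound_tc_def)

lemma sound_check: "sound_tc ck \<Longrightarrow> ctx \<Gamma> \<Longrightarrow> valid \<Gamma> T' \<Longrightarrow> ck \<Gamma> (Some T') t = Some T \<Longrightarrow> \<Gamma> \<turnstile> t : T'"
  by (auto simp: sound_tc_def)

lemma valid_ctx: "valid \<Gamma> A \<Longrightarrow> ctx (A # \<Gamma>)"
  by (auto simp: valid_def intro: ctx_Cons)

lemma valid_Pi_codomain: "valid \<Gamma> (Pi A B) \<Longrightarrow> valid (A # \<Gamma>) B"
  unfolding valid_def using Pi_formation by blast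

lemma valid_Pi_domain: "valid \<Gamma> (Pi A B) \<Longrightarrow> valid \<Gamma> A"
  unfolding valid_def using Pi_formation by blast

lemma Pi_level: "\<Gamma> \<turnstile> A : U i \<Longrightarrow> A # \<Gamma> \<turnstile> B : U j \<Longrightarrow> \<Gamma> \<turnstile> Pi A B : U (max i j)"
  by (rule ty_Pi; erule cumul_le; simp)

lemma univ_view_SomeD: "univ_view t = Some i \<Longrightarrow> t = U i"
  by (cases t rule: univ_view.cases) auto

lemma level_of_sound:
  assumes "sound_red w" "sound_tc ck" "ctx \<Gamma>" "level_of w (ck \<Gamma> None A) = Some i"
  shows "\<Gamma> \<turnstile> A : U i"
proof -
  obtain T where T: "ck \<Gamma> None A = Some T" "w T [] = U i"
    using assms(4) univ_view_SomeD by (cases "ck \<Gamma> None A") auto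
  show ?thesis
    using sound_synth[OF assms(2,3) T(1)] sound_red_Nil[OF assms(1), of T] T(2) assms(3)
    by (auto intro: ty_conv ty_U)
qed

lemma valid_Pi_sound:
  assumes "sound_red w" "sound_tc ck" "ctx \<Gamma>" "valid_Pi w ck \<Gamma> T = Some (A, B)"
  shows "T = Pi A B \<and> valid \<Gamma> (Pi A B)"
proof -
  obtain A' B' where T: "T = Pi A' B'" using assms(4) by (cases T) auto
  then obtain i where "level_of w (ck \<Gamma> None T) = Some i" "A' = A" "B' = B"
    using assms(4) by (cases "level_of w (ck \<Gamma> None T)") auto
  then show ?thesis using level_of_sound[OF assms(1-3)] T by (auto simp: valid_def)
qed

lemma as_Pi_sound:
  assumes "sound_red w" "sound_tc ck" "ctx \<Gamma>" "valid \<Gamma> T" "as_Pi w ck \<Gamma> T = Some (A, B)"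
  shows "T \<equiv>\<^sub>J Pi A B \<and> valid \<Gamma> (Pi A B)"
proof (cases "\<exists>A B. T = Pi A B")
  case True
  then show ?thesis using assms by auto
next
  case False
  then have "valid_Pi w ck \<Gamma> (w T []) = Some (A, B)"
    using assms(5) by (cases T) auto
  from valid_Pi_sound[OF assms(1-3) this] sound_red_Nil[OF assms(1), of T] show ?thesis by auto
qed

lemma synth_Var_sound: "synth_Var m k \<Gamma> = Some T \<Longrightarrow> k < length \<Gamma> \<and> T = lift m 0 (\<Gamma> ! k)"
  by (induction m k \<Gamma> rule: synth_Var.induct) auto

lemma valid_nth: "ctx \<Gamma> \<Longrightarrow> k < length \<Gamma> \<Longrightarrow> valid \<Gamma> (lift (Suc k) 0 (\<Gamma> ! k))"
proof -
  assume c: "ctx \<Gamma>" and k: "k < length \<Gamma>"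
  have e: "\<Gamma> = take (Suc k) \<Gamma> @ drop (Suc k) \<Gamma>" "drop k \<Gamma> = \<Gamma> ! k # drop (Suc k) \<Gamma>"
    using k by (simp_all add: Cons_nth_drop_Suc)
  have "ctx (\<Gamma> ! k # drop (Suc k) \<Gamma>)" using ctx_drop[OF c] e(2) by metis
  then obtain i where "drop (Suc k) \<Gamma> \<turnstile> \<Gamma> ! k : U i" by (auto elim: ctx.cases)
  from weaken_append[OF this, of "take (Suc k) \<Gamma>"] show ?thesis
    using c k by (auto simp: valid_def min_absorb2 Suc_leI)
qed

text \<open>The validity of the result type in the application case rests on the substitution lemma and on inversion for \<open>Pi\<close>.\<close>

lemma synth_step_sound:
  assumes S: "\<And>c. S c \<Longrightarrow> valid [] (ctype c)" and w: "sound_red w" and ck: "sound_tc ck"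
    and c: "ctx \<Gamma>" and t: "synth_step S w ck \<Gamma> t = Some T"
  shows "\<Gamma> \<turnstile> t : T \<and> valid \<Gamma> T"
proof (cases t)
  case (Var k)
  then show ?thesis using t synth_Var_sound[of "Suc k" k \<Gamma> T] valid_nth[OF c] c by (auto intro: ty_Var)
next
  case (U i)
  then show ?thesis using t c ty_U[OF c] by (auto simp: valid_def)
next
  case (Con k)
  have k: "S k" "T = ctype k" using t Con by (cases "S k"; auto)+
  then obtain j where "[] \<turnstile> ctype k : U j" using S by (auto simp: valid_def)
  from weaken_append[OF this, of \<Gamma>] show ?thesis using c k Con by (auto simp: valid_def intro: ty_Con)
next
  case (Pi A B)
  obtain i where i: "level_of w (ck \<Gamma> None A) = Some i"
    using t Pi by (cases "level_of w (ck \<Gamma> None A)") auto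
  have A: "\<Gamma> \<turnstile> A : U i" by (rule level_of_sound[OF w ck c i])
  obtain j where j: "level_of w (ck (A # \<Gamma>) None B) = Some j" and T: "T = U (max i j)"
    using t Pi i by (cases "level_of w (ck (A # \<Gamma>) None B)") auto
  have "A # \<Gamma> \<turnstile> B : U j" by (rule level_of_sound[OF w ck ctx_Cons[OF A] j])
  then show ?thesis using Pi_level[OF A] Pi T ty_U[OF c] by (auto simp: valid_def)
next
  case (Lam A b)
  obtain i where i: "level_of w (ck \<Gamma> None A) = Some i"
    using t Lam by (cases "level_of w (ck \<Gamma> None A)") auto
  have A: "\<Gamma> \<turnstile> A : U i" by (rule level_of_sound[OF w ck c i])
  obtain B where B: "ck (A # \<Gamma>) None b = Some B" and T: "T = Pi A B"
    using t Lam i by (cases "ck (A # \<Gamma>) None b") auto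
  show ?thesis using sound_synth[OF ck ctx_Cons[OF A] B] Pi_level[OF A] Lam T
    by (auto simp: valid_def intro: ty_Lam)
next
  case (App f a)
  obtain F where F: "ck \<Gamma> None f = Some F" using t App by (cases "ck \<Gamma> None f") auto
  obtain A B where AB: "as_Pi w ck \<Gamma> F = Some (A, B)"
    using t App F by (cases "as_Pi w ck \<Gamma> F") auto
  obtain A' where a: "ck \<Gamma> (Some A) a = Some A'" and T: "T = subst 0 a B"
    using t App F AB by (cases "ck \<Gamma> (Some A) a") auto
  have f: "\<Gamma> \<turnstile> f : F" "valid \<Gamma> F" using sound_synth[OF ck c F] by auto
  have P: "F \<equiv>\<^sub>J Pi A B" "valid \<Gamma> (Pi A B)" using as_Pi_sound[OF w ck c f(2) AB] by auto
  have a: "\<Gamma> \<turnstile> a : A" by (rule sound_check[OF ck c valid_Pi_domain[OF P(2)] a])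
  have "\<Gamma> \<turnstile> f : Pi A B" using f(1) P by (auto simp: valid_def intro: ty_conv)
  then show ?thesis using ty_App[OF _ a] codomain_subst[OF _ a] P(2) App T by (auto simp: valid_def)
qed

lemma check_Lam2_sound:
  assumes w: "sound_red w" and cv: "sound_cmp cv" and ck: "sound_tc ck"
    and P: "valid \<Gamma> (Pi A' B)" and c: "ctx \<Gamma>"
    and t: "check_Lam2 w cv ck \<Gamma> A b A' B (A = A') = Some T"
  shows "\<Gamma> \<turnstile> Lam A b : Pi A' B"
proof (cases "A = A'")
  case True
  have B: "valid (A # \<Gamma>) B" using valid_Pi_codomain[OF P] True by simp
  have "ck (A # \<Gamma>) (Some B) b = Some T" using t True by simp
  from sound_check[OF ck _ B this] show ?thesis
    using valid_ctx[OF valid_Pi_domain[OF P]] True by (auto intro: ty_Lam)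
next
  case False
  then obtain i j where h: "cv A A'" "level_of w (ck \<Gamma> None A) = Some i"
      "level_of w (ck (A # \<Gamma>) None B) = Some j" "ck (A # \<Gamma>) (Some B) b = Some T"
    using t by (cases "(ck, \<Gamma>, A, b, B, cv A A', level_of w (ck \<Gamma> None A), level_of w (ck (A # \<Gamma>) None B))"
        rule: check_Lam3.cases) auto
  have A: "\<Gamma> \<turnstile> A : U i" by (rule level_of_sound[OF w ck c h(2)])
  have B: "A # \<Gamma> \<turnstile> B : U j" by (rule level_of_sound[OF w ck ctx_Cons[OF A] h(3)])
  have "A # \<Gamma> \<turnstile> b : B" using sound_check[OF ck ctx_Cons[OF A] _ h(4)] B by (auto simp: valid_def)
  moreover have "Pi A B \<equiv>\<^sub>J Pi A' B" using sound_cmpD[OF cv h(1)] by (auto intro: conv_Pi)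
  ultimately show ?thesis using P by (auto simp: valid_def intro: ty_conv[OF ty_Lam])
qed

lemma sub_univ_SomeD: "sub_univ s t \<Longrightarrow> \<exists>i j. s = U i \<and> t = U j \<and> i \<le> j"
  by (cases "(s, t)" rule: sub_univ.cases) auto

lemma check_sub_sound:
  assumes w: "sound_red w" and cv: "sound_cmp cv" and ck: "sound_tc ck" 
    and V: "valid \<Gamma> T" and c: "ctx \<Gamma>"
    and t: "check_sub w cv T (ck \<Gamma> None t) = Some T'"
  shows "\<Gamma> \<turnstile> t : T"
proof -
  obtain S where S: "ck \<Gamma> None t = Some S" using t by (cases "ck \<Gamma> None t") auto
  have tS: "\<Gamma> \<turnstile> t : S" using sound_synth[OF ck c S] by simp
  show ?thesis
  proof (cases "cv S T")
    case True
    then show ?thesis using tS V sound_cmpD[OF cv] by (auto simp: valid_def intro: ty_conv)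
  next
    case False
    then have "sub_univ (w S []) (w T [])" using t S by (cases "sub_univ (w S []) (w T [])") auto
    then obtain i j where ij: "w S [] = U i" "w T [] = U j" "i \<le> j" using sub_univ_SomeD by blast
    have "\<Gamma> \<turnstile> t : U i" using ty_conv[OF tS _ ty_U[OF c]] sound_red_Nil[OF w, of S] ij(1) by simp
    then have "\<Gamma> \<turnstile> t : U j" using cumul_le ij(3) by blast
    moreover have "U j \<equiv>\<^sub>J T" using conv_sym[OF sound_red_Nil[OF w, of T]] ij(2) by simp
    ultimately show ?thesis using V by (auto simp: valid_def intro: ty_conv)
  qed
qed

lemma check_step_sound:
  assumes w: "sound_red w" and cv: "sound_cmp cv" and ck: "sound_tc ck" 
    and V: "valid \<Gamma> T" and c: "ctx \<Gamma>" and t: "check_step w cv ck \<Gamma> T t = Some T'"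
  shows "\<Gamma> \<turnstile> t : T"
proof (cases "\<exists>A b. t = Lam A b")
  case True
  then obtain A b where l: "t = Lam A b" by blast
  obtain A' B where AB: "as_Pi w ck \<Gamma> T = Some (A', B)"
    using t l by (cases "as_Pi w ck \<Gamma> T") auto
  have P: "T \<equiv>\<^sub>J Pi A' B" "valid \<Gamma> (Pi A' B)" using as_Pi_sound[OF w ck c V AB] by auto
  have "\<Gamma> \<turnstile> Lam A b : Pi A' B"
    using check_Lam2_sound[OF w cv ck P(2) c, of A b T'] t l AB by simp
  then show ?thesis using V conv_sym[OF P(1)] l by (auto simp: valid_def intro: ty_conv)
next
  case False
  then have "check_sub w cv T (ck \<Gamma> None t) = Some T'" using t by (cases t) auto
  from check_sub_sound[OF w cv ck V c this] show ?thesis .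
qed

definition sound_sig :: "(const \<Rightarrow> bool) \<Rightarrow> (tm \<Rightarrow> tm option) \<Rightarrow> bool" where
  "sound_sig S D \<longleftrightarrow> (\<forall>c. S c \<longrightarrow> valid [] (ctype c)) \<and>
     (\<forall>t T. D t = Some T \<longrightarrow> [] \<turnstile> t : T \<and> valid [] T \<and> (\<forall>n. lift n 0 t = t \<and> lift n 0 T = T))"

lemma known_sound: "sound_sig S D \<Longrightarrow> D t = Some T \<Longrightarrow> ctx \<Gamma> \<Longrightarrow> \<Gamma> \<turnstile> t : T \<and> valid \<Gamma> T"
proof -
  assume "sound_sig S D" "D t = Some T" and c: "ctx \<Gamma>"
  then have t: "[] \<turnstile> t : T" "valid [] T" and l: "\<And>n. lift n 0 t = t" "\<And>n. lift n 0 T = T"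
    by (auto simp: sound_sig_def)
  obtain k where "[] \<turnstile> T : U k" using t(2) by (auto simp: valid_def)
  from weaken_append[OF this, of \<Gamma>] weaken_append[OF t(1), of \<Gamma>] c l show ?thesis
    by (auto simp: valid_def)
qed

theorem tc_sound:
  assumes sig: "sound_sig S D"
  shows "sound_tc (tc S D n)"
proof (induction n)
  case 0
  show ?case by (simp add: sound_tc_def)
next
  case (Suc n)
  have S: "\<And>c. S c \<Longrightarrow> valid [] (ctype c)" using sig by (auto simp: sound_sig_def)
  show ?case unfolding sound_tc_def
  proof (intro allI impI conjI)
    fix \<Gamma> t T assume c: "ctx \<Gamma>"
    have s: "\<Gamma> \<turnstile> t : T \<and> valid \<Gamma> T" if "tc S D (Suc n) \<Gamma> None t = Some T"
      using that synth_step_sound[OF S reduction_sound(1) Suc c] known_sound[OF sig _ c] by (cases "D t") auto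
    then show "\<Gamma> \<turnstile> t : T" "valid \<Gamma> T" if "tc S D (Suc n) \<Gamma> None t = Some T" using that by auto
    fix T' assume V: "valid \<Gamma> T'" and t: "tc S D (Suc n) \<Gamma> (Some T') t = Some T"
    show "\<Gamma> \<turnstile> t : T'"
    proof (cases "D t")
      case None
      then show ?thesis using t check_step_sound[OF reduction_sound Suc V c] by simp
    next
      case (Some T'')
      have "sound_tc (\<lambda>\<Gamma> m t. if m = None then D t else None)"
        using known_sound[OF sig] by (auto simp: sound_tc_def)
      from check_sub_sound[OF reduction_sound(1)[of n] reduction_sound(2)[of n] this V c, of t T] show ?thesis using t Some by simp
    qed
  qed
qed

lemma accepts_sound:
  assumes sig: "sound_sig S D" and "accepts S D n t T"
  shows "[] \<turnstile> t : T"
proof -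
  obtain i T' where "level_of (whnf n) (tc S D n [] None T) = Some i" and t: "tc S D n [] (Some T) t = Some T'"
    using assms(2) by (auto simp: accepts_def)
  with level_of_sound[OF reduction_sound(1) tc_sound[OF sig] ctx_Nil] have "valid [] T"
    unfolding valid_def by blast
  then show ?thesis using sound_check[OF tc_sound[OF sig] ctx_Nil _ t] by blast
qed

section \<open>Evaluating the type checker\<close>

text \<open>The universe level \<open>i\<close> stays a variable during evaluation. The following
equations cover the comparisons between \<open>0\<close>, \<open>i\<close> and its successors that arise.\<close>

lemma max_Suc_self: "max n (Suc n) = Suc n" "max (Suc n) n = Suc n" "max n n = (n::nat)"
  "max 0 n = n" "max n 0 = n" "max n (Suc (Suc n)) = Suc (Suc n)" "max (Suc (Suc n)) n = Suc (Suc n)" by auto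
lemma le_self: "n \<le> (n::nat)" "n \<le> Suc n" "(Suc n \<le> n) = False" "(Suc n \<le> 0) = False" "0 \<le> n" "n \<le> Suc (Suc n)" by auto

lemma diffs: "Suc m - Suc n = m - n" "n - (0::nat) = n" "Suc n - 1 = n" by auto
lemma adds: "m + Suc n = Suc (m + n)" "m + (0::nat) = m" by auto
lemma Suc_neq: "(Suc n = n) = False" "(n = Suc n) = False" by auto
lemma Some_neq: "(Some x \<noteq> None) = True" "(None \<noteq> None) = False" by auto

text \<open>The instance of reflexivity has a constant on its right side and is therefore tried before injectivity, so that
identical terms are compared in one step.\<close>

lemmas tmeq = tm.inject tm.distinct const.inject const.distinct nat.inject nat.distinct Suc_neq refl[THEN eqTrueI]
lemmas nats = max_Suc_self le_self diffs adds not_less_zero zero_less_Suc Suc_less_eq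

lemma conjs: "(True \<and> x) = x" "(False \<and> x) = False" by auto

text \<open>Conditionals would be evaluated in both branches; these variants decide by constructor patterns which branch is
built.\<close>

fun subst_var :: "nat \<Rightarrow> tm \<Rightarrow> nat \<Rightarrow> bool \<Rightarrow> bool \<Rightarrow> tm" where
  "subst_var k s x True b = Var x"
| "subst_var 0 s x False True = s"
| "subst_var (Suc k) s x False True = lift (Suc k) 0 s"
| "subst_var k s x False False = Var (x - Suc 0)"

lemma subst_Var: "subst k s (Var x) = subst_var k s x (x < k) (x = k)"
  by (cases k) auto

fun lift_var :: "nat \<Rightarrow> nat \<Rightarrow> bool \<Rightarrow> tm" where
  "lift_var n x True = Var x"
| "lift_var n x False = Var (x + n)"

lemma lift_Var: "lift n k (Var x) = lift_var n x (x < k)"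
  by simp

lemmas checker_eqs = apps_simps nat_con.simps nat_view.simps refl_con.simps refl_view.simps sin_con.simps sin_view.simps
  pair_con.simps pair_view.simps nat_redex.simps fire.simps J_redex.simps pair_redex.simps sin_redex.simps
  whnf_con.simps whnf_step.simps spine.simps conv_list.simps conv_next.simps conv_whnf.simps conv_step.simps
  whnf.simps conv_ck.simps univ_view.simps level_of.simps if_level.simps valid_Pi.simps as_Pi.simps as_Pi_opt.simps
  app_result.simps synth_App.simps synth_Pi2.simps synth_Pi.simps synth_Lam2.simps synth_Lam.simps synth_Var.simps
  synth_Con.simps synth_step.simps guard.simps sub_univ.simps check_sub2.simps check_sub.simps check_Lam3.simps check_Lam2.simps
  check_Lam.simps check_step.simps tc.simps synth_known.simps check_known.simps accepts_def option.inject
  lift_Var lift_var.simps lift.simps(2-) subst_Var subst_var.simps subst.simps(2-) nats conjs tmeq Some_neq not_False_eq_True not_True_eq_False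

text \<open>The checker assumes that the types of the constants it uses are valid. It can establish this itself in stages: the
type of a constant of rank at most three mentions constants of smaller rank only. Constants of rank four are excluded
from proof terms.\<close>

fun rank :: "const \<Rightarrow> nat" where
  "rank CNat = 0" | "rank (CId i) = 0" | "rank (CSig i) = 0" | "rank (CPTrunc i) = 0" | "rank (CSTrunc i) = 0"
| "rank CZero = Suc 0" | "rank CSucc = Suc 0" | "rank (CRefl i) = Suc 0" | "rank (CPair i) = Suc 0"
| "rank (CPIn i) = Suc 0" | "rank (CPProp i) = Suc 0" | "rank (CSIn i) = Suc 0" | "rank (CSSet i) = Suc 0"
| "rank (CNatInd j) = Suc (Suc 0)" | "rank (CSigInd i j) = Suc (Suc 0)" | "rank (CJ i j) = Suc (Suc 0)"
| "rank (CPInd i j) = Suc (Suc 0)" | "rank (CSInd i j) = Suc (Suc 0)"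
| "rank (CFunext i) = Suc (Suc (Suc 0))"
| "rank c = Suc (Suc (Suc (Suc 0)))"

definition below :: "nat \<Rightarrow> const \<Rightarrow> bool" where
  "below m c = (rank c < m)"

lemmas hoas = exp_defs nats

text \<open>The raw form of the type of each constant, computed once.\<close>

lemmas ctype_eqs =
  ctype_def[of CNat, simplified ctypeE.simps hoas]
  ctype_def[of CZero, simplified ctypeE.simps hoas]
  ctype_def[of CSucc, simplified ctypeE.simps hoas]
  ctype_def[of "CNatInd j" for j, simplified ctypeE.simps hoas]
  ctype_def[of "CSig i" for i, simplified ctypeE.simps hoas]
  ctype_def[of "CPair i" for i, simplified ctypeE.simps hoas]
  ctype_def[of "CSigInd i j" for i j, simplified ctypeE.simps hoas]
  ctype_def[of "CId i" for i, simplified ctypeE.simps hoas]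
  ctype_def[of "CRefl i" for i, simplified ctypeE.simps hoas]
  ctype_def[of "CJ i j" for i j, simplified ctypeE.simps hoas]
  ctype_def[of "CPTrunc i" for i, simplified ctypeE.simps hoas]
  ctype_def[of "CPIn i" for i, simplified ctypeE.simps hoas]
  ctype_def[of "CPProp i" for i, simplified ctypeE.simps hoas]
  ctype_def[of "CPInd i j" for i j, simplified ctypeE.simps hoas]
  ctype_def[of "CSTrunc i" for i, simplified ctypeE.simps hoas]
  ctype_def[of "CSIn i" for i, simplified ctypeE.simps hoas]
  ctype_def[of "CSSet i" for i, simplified ctypeE.simps hoas]
  ctype_def[of "CSInd i j" for i j, simplified ctypeE.simps hoas]
  ctype_def[of "CFunext i" for i, simplified ctypeE.simps hoas]

text \<open>A recursion depth that suffices for all terms below.\<close>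

definition fuel :: nat where "fuel = 100"

lemmas fuel_Suc = fuel_def[simplified numeral_eq_Suc pred_numeral_simps BitM.simps One_nat_def arith_simps]

lemmas base_eqs = checker_eqs rank.simps below_def hoas ctype_eqs fuel_Suc

definition nothing :: "tm \<Rightarrow> tm option" where
  "nothing t = None"

lemma valid_ctype_step:
  assumes "\<And>c. rank c < m \<Longrightarrow> valid [] (ctype c)"
    and "level_of (whnf fuel) (tc (below m) nothing fuel [] None (ctype d)) \<noteq> None"
  shows "valid [] (ctype d)"
proof -
  have "sound_sig (below m) nothing" by (simp add: sound_sig_def below_def nothing_def assms(1))
  from level_of_sound[OF reduction_sound(1) tc_sound[OF this] ctx_Nil, of fuel] show ?thesis
    using assms(2) unfolding valid_def by blast
qed

lemma valid_ctype0: "rank c < Suc 0 \<Longrightarrow> valid [] (ctype c)"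
  apply (rule valid_ctype_step[where m = 0], simp)
  apply (cases c; simp only: base_eqs nothing_def cong: conj_left_cong)
  done

lemma valid_ctype1: "rank c < Suc (Suc 0) \<Longrightarrow> valid [] (ctype c)"
  apply (rule valid_ctype_step[OF valid_ctype0], assumption)
  apply (cases c; simp only: base_eqs nothing_def cong: conj_left_cong)
  done

lemma valid_ctype2: "rank c < Suc (Suc (Suc 0)) \<Longrightarrow> valid [] (ctype c)"
  apply (rule valid_ctype_step[OF valid_ctype1], assumption)
  apply (cases c; simp only: base_eqs nothing_def cong: conj_left_cong)
  done

lemma valid_ctype3: "rank c < Suc (Suc (Suc (Suc 0))) \<Longrightarrow> valid [] (ctype c)"
  apply (rule valid_ctype_step[OF valid_ctype2], assumption)
  apply (cases c; simp only: base_eqs nothing_def cong: conj_left_cong)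
  done

abbreviation usable where "usable \<equiv> below (Suc (Suc (Suc (Suc 0))))"

text \<open>The function that takes loop spaces is a large closed term, and it occurs in every iterated loop space. It is named and entered into the table of known terms. The equations below make the name behave like the
abstraction that it denotes, without unfolding it except when it is applied.\<close>

definition ptd_tm :: "nat \<Rightarrow> tm" where
  "ptd_tm i = PtdE i 0"

definition loop_body :: "nat \<Rightarrow> tm" where
  "loop_body i = LoopE i (\<lambda>m. Var (m - Suc 0)) (Suc 0)"

definition loop_fn :: "nat \<Rightarrow> tm" where
  "loop_fn i = Lam (ptd_tm i) (loop_body i)"

definition known :: "nat \<Rightarrow> tm \<Rightarrow> tm option" where
  "known i t = (if t = loop_fn i then Some (Pi (ptd_tm i) (ptd_tm i)) else None)"

lemmas ptd_tm_eq = ptd_tm_def[simplified hoas]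
lemmas loop_body_eq = loop_body_def[simplified hoas]

lemma typing_loop_fn: "[] \<turnstile> loop_fn i : Pi (ptd_tm i) (ptd_tm i)"
proof (rule accepts_sound)
  show "sound_sig usable nothing" by (simp add: sound_sig_def below_def nothing_def valid_ctype3)
  show "accepts usable nothing fuel (loop_fn i) (Pi (ptd_tm i) (ptd_tm i))"
    by (simp only: loop_fn_def ptd_tm_eq loop_body_eq base_eqs nothing_def cong: conj_left_cong)
qed

lemma valid_loop_fn: "valid [] (Pi (ptd_tm i) (ptd_tm i))"
proof -
  have "sound_sig usable nothing" by (simp add: sound_sig_def below_def nothing_def valid_ctype3)
  moreover have "accepts usable nothing fuel (Pi (ptd_tm i) (ptd_tm i)) (U (Suc (Suc i)))"
    by (simp only: ptd_tm_eq base_eqs nothing_def cong: conj_left_cong)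
  ultimately show ?thesis using accepts_sound unfolding valid_def by blast
qed

lemma ptd_tm_closed: "lift n k (ptd_tm i) = ptd_tm i" "subst k s (ptd_tm i) = ptd_tm i"
  by (simp_all add: ptd_tm_eq)

lemma loop_fn_closed: "lift n k (loop_fn i) = loop_fn i" "subst k s (loop_fn i) = loop_fn i"
  by (simp_all add: loop_fn_def ptd_tm_closed) (simp_all add: loop_body_eq)

lemma usable_sound: "sound_sig usable (known i)"
  using typing_loop_fn valid_loop_fn
  by (auto simp: sound_sig_def below_def known_def ptd_tm_closed loop_fn_closed valid_ctype3)

fun known_lam :: "nat \<Rightarrow> bool \<Rightarrow> tm option" where
  "known_lam i True = Some (Pi (ptd_tm i) (ptd_tm i))"
| "known_lam i False = None"

lemma known_simps:
  "known i (Var k) = None" "known i (U j) = None" "known i (Con c) = None" "known i (Pi A B) = None"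
  "known i (f \<degree> a) = None" "known i (Lam A b) = known_lam i (A = ptd_tm i \<and> b = loop_body i)"
  "known i (loop_fn i) = Some (Pi (ptd_tm i) (ptd_tm i))"
  by (auto simp: known_def loop_fn_def)

lemma loop_fn_neq:
  "(loop_fn i = Var k) = False" "(loop_fn i = U j) = False" "(loop_fn i = Con c) = False"
  "(loop_fn i = Pi A B) = False" "(loop_fn i = f \<degree> a) = False"
  "(loop_fn i = Lam A b) = (ptd_tm i = A \<and> loop_body i = b)"
  "(Var k = loop_fn i) = False" "(U j = loop_fn i) = False" "(Con c = loop_fn i) = False"
  "(Pi A B = loop_fn i) = False" "(f \<degree> a = loop_fn i) = False"
  "(Lam A b = loop_fn i) = (A = ptd_tm i \<and> b = loop_body i)"
  by (auto simp: loop_fn_def)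

lemma whnf_step_loop_fn:
  "whnf_step w cv (loop_fn i) [] = loop_fn i"
  "whnf_step w cv (loop_fn i) (a # as) = w (subst 0 a (loop_body i)) as"
  by (auto simp: loop_fn_def)

lemma loop_fn_E: "(\<^bold>\<lambda> P : PtdE i. LoopE i P) = (\<lambda>n. loop_fn i)"
  by (rule ext) (simp add: loop_fn_def ptd_tm_def loop_body_def exp_defs Suc_diff_le)

lemma LoopnE_fold: "LoopnE i n X x0 = K (CNatInd (Suc i)) \<cdot> (\<^bold>\<lambda> _ : NatE. PtdE i) \<cdot> ptdE i X x0 \<cdot>
    (\<lambda>m. Lam (Con CNat) (loop_fn i)) \<cdot> n"
  unfolding LoopnE_def loop_fn_E by (simp add: LamE_def NatE_def K_def)

lemmas loop_rules = known_simps known_lam.simps loop_fn_closed loop_fn_neq whnf_step_loop_fn ptd_tm_eq loop_body_eq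

text \<open>Evaluation is rewriting with these equations and nothing else. It is always combined with the congruence rule
\<open>conj_left_cong\<close>, which leaves the second conjunct of a comparison alone until the first one has become true.\<close>

lemmas checking_eqs = LoopnE_fold base_eqs loop_rules

lemma inhabitedI: "accepts usable (known i) fuel (t 0) (T 0) \<Longrightarrow> inhabited T"
  unfolding inhabited_def using accepts_sound[OF usable_sound] by blast

text \<open>A lemma enters a later proof term as a hypothesis, so that the checker sees its statement but not its proof term.
The side condition says that the conclusion is closed.\<close>

lemma inhabited_mp:
  assumes "inhabited (A \<rightarrow> B)" "inhabited A" "\<And>a. subst 0 a (B (Suc 0)) = B 0"
  shows "inhabited B"
  using assms unfolding inhabited_def ArrE_def PiE_def by (metis ty_App)

section \<open>Path algebra and set truncations\<close>

text \<open>The definitions of the statements and of the operations that occur in them, all of which evaluation unfolds.\<close>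

named_theorems laws

lemma inhabited_from1:
  assumes "inhabited A" "accepts usable (known i) fuel (t 0) ((A \<rightarrow> B) 0)" "\<And>a. subst 0 a (B (Suc 0)) = B 0"
  shows "inhabited B"
  using inhabited_mp[of A B] inhabitedI[of i t] assms by blast

lemma inhabited_from2:
  assumes "inhabited A" "inhabited A'" "accepts usable (known i) fuel (t 0) ((A \<rightarrow> A' \<rightarrow> B) 0)"
    "\<And>a. subst 0 a ((A' \<rightarrow> B) (Suc 0)) = (A' \<rightarrow> B) 0" "\<And>a. subst 0 a (B (Suc 0)) = B 0"
  shows "inhabited B"
  using inhabited_from1[of A i t "A' \<rightarrow> B"] inhabited_mp[of A' B] assms by blast

lemma inhabited_from3:
  assumes "inhabited A" "inhabited A'" "inhabited A''" "accepts usable (known i) fuel (t 0) ((A \<rightarrow> A' \<rightarrow> A'' \<rightarrow> B) 0)"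
    "\<And>a. subst 0 a ((A' \<rightarrow> A'' \<rightarrow> B) (Suc 0)) = (A' \<rightarrow> A'' \<rightarrow> B) 0"
    "\<And>a. subst 0 a ((A'' \<rightarrow> B) (Suc 0)) = (A'' \<rightarrow> B) 0" "\<And>a. subst 0 a (B (Suc 0)) = B 0"
  shows "inhabited B"
  using inhabited_from2[of A A' i t "A'' \<rightarrow> B"] inhabited_mp[of A'' B] assms by blast

text \<open>Path induction with motive and base case given as expressions with bound variables.\<close>

definition JE :: "nat \<Rightarrow> exp \<Rightarrow> (exp \<Rightarrow> exp \<Rightarrow> exp \<Rightarrow> exp) \<Rightarrow> (exp \<Rightarrow> exp) \<Rightarrow> exp \<Rightarrow> exp \<Rightarrow> exp \<Rightarrow> exp" where [laws]:
  "JE i A C c a b p = K (CJ i i) \<cdot> A \<cdot> (\<^bold>\<lambda> x : A. \<^bold>\<lambda> y : A. \<^bold>\<lambda> q : EqE i A x y. C x y q) \<cdot> (\<^bold>\<lambda> x : A. c x) \<cdot> a \<cdot> b \<cdot> p"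

definition apE :: "nat \<Rightarrow> exp \<Rightarrow> exp \<Rightarrow> (exp \<Rightarrow> exp) \<Rightarrow> exp \<Rightarrow> exp \<Rightarrow> exp \<Rightarrow> exp" where [laws]:
  "apE i A B f a b p = JE i A (\<lambda>x y _. EqE i B (f x) (f y)) (\<lambda>x. reflE i B (f x)) a b p"

text \<open>Concatenation is defined by induction on its first argument, so only the right unit law needs a proof.\<close>

definition right_unit_law :: "nat \<Rightarrow> exp" where [laws]:
  "right_unit_law i = (\<^bold>\<Pi> A : Type i. \<^bold>\<Pi> x : A. \<^bold>\<Pi> y : A. \<^bold>\<Pi> p : EqE i A x y.
     EqE i (EqE i A x y) (concatE i A x y y p (reflE i A y)) p)"

lemma right_unit: "inhabited (right_unit_law i)"
  by (rule inhabitedI[where i = i and t = "\<^bold>\<lambda> A : Type i. \<^bold>\<lambda> x : A. \<^bold>\<lambda> y : A. \<^bold>\<lambda> p : EqE i A x y.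
      JE i A (\<lambda>x y p. EqE i (EqE i A x y) (concatE i A x y y p (reflE i A y)) p)
        (\<lambda>x. reflE i (EqE i A x x) (reflE i A x)) x y p"])
    (simp_all only: laws checking_eqs cong: conj_left_cong)

definition left_inverse_law :: "nat \<Rightarrow> exp" where [laws]:
  "left_inverse_law i = (\<^bold>\<Pi> A : Type i. \<^bold>\<Pi> x : A. \<^bold>\<Pi> y : A. \<^bold>\<Pi> p : EqE i A x y.
     EqE i (EqE i A y y) (reflE i A y) (concatE i A y x y (invE i A x y p) p))"

lemma left_inverse: "inhabited (left_inverse_law i)"
  by (rule inhabitedI[where i = i and t = "\<^bold>\<lambda> A : Type i. \<^bold>\<lambda> x : A. \<^bold>\<lambda> y : A. \<^bold>\<lambda> p : EqE i A x y.
      JE i A (\<lambda>x y p. EqE i (EqE i A y y) (reflE i A y) (concatE i A y x y (invE i A x y p) p))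
        (\<lambda>x. reflE i (EqE i A x x) (reflE i A x)) x y p"])
    (simp_all only: laws checking_eqs cong: conj_left_cong)

definition cancel_inverse_law :: "nat \<Rightarrow> exp" where [laws]:
  "cancel_inverse_law i = (\<^bold>\<Pi> A : Type i. \<^bold>\<Pi> x : A. \<^bold>\<Pi> y : A. \<^bold>\<Pi> p : EqE i A x y. \<^bold>\<Pi> z : A. \<^bold>\<Pi> q : EqE i A x z.
     EqE i (EqE i A x z) (concatE i A x y z p (concatE i A y x z (invE i A x y p) q)) q)"

lemma cancel_inverse: "inhabited (cancel_inverse_law i)"
  by (rule inhabitedI[where i = i and t = "\<^bold>\<lambda> A : Type i. \<^bold>\<lambda> x : A. \<^bold>\<lambda> y : A. \<^bold>\<lambda> p : EqE i A x y.
      JE i A (\<lambda>x y p. \<^bold>\<Pi> z : A. \<^bold>\<Pi> q : EqE i A x z.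
          EqE i (EqE i A x z) (concatE i A x y z p (concatE i A y x z (invE i A x y p) q)) q)
        (\<lambda>x. \<^bold>\<lambda> z : A. \<^bold>\<lambda> q : EqE i A x z. reflE i (EqE i A x z) q) x y p"])
    (simp_all only: laws checking_eqs cong: conj_left_cong)

text \<open>If \<open>h\<close> connects any two points, every path is equal to one built from \<open>h\<close> alone; hence any two parallel paths are equal,
which is why propositions are sets.\<close>

definition prop_paths_law :: "nat \<Rightarrow> exp" where [laws]:
  "prop_paths_law i = (\<^bold>\<Pi> A : Type i. \<^bold>\<Pi> h : isProp i A. \<^bold>\<Pi> x : A. \<^bold>\<Pi> y : A. \<^bold>\<Pi> p : EqE i A x y.
     EqE i (EqE i A x y) p (concatE i A x x y (invE i A x x (h \<cdot> x \<cdot> x)) (h \<cdot> x \<cdot> y)))"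

lemma prop_paths: "inhabited (prop_paths_law i)"
  by (rule inhabited_from1[OF left_inverse[of i], where i = i and t = "\<^bold>\<lambda> inv : left_inverse_law i.
      \<^bold>\<lambda> A : Type i. \<^bold>\<lambda> h : isProp i A. \<^bold>\<lambda> x : A. \<^bold>\<lambda> y : A. \<^bold>\<lambda> p : EqE i A x y.
      JE i A (\<lambda>x y p. EqE i (EqE i A x y) p (concatE i A x x y (invE i A x x (h \<cdot> x \<cdot> x)) (h \<cdot> x \<cdot> y)))
        (\<lambda>x. inv \<cdot> A \<cdot> x \<cdot> x \<cdot> (h \<cdot> x \<cdot> x)) x y p"])
    (simp_all only: laws checking_eqs cong: conj_left_cong)

definition prop_is_set_law :: "nat \<Rightarrow> exp" where [laws]:
  "prop_is_set_law i = (\<^bold>\<Pi> A : Type i. isProp i A \<rightarrow> isSet i A)"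

lemma prop_is_set: "inhabited (prop_is_set_law i)"
  by (rule inhabited_from1[OF prop_paths[of i], where i = i and t = "\<^bold>\<lambda> pp : prop_paths_law i.
      \<^bold>\<lambda> A : Type i. \<^bold>\<lambda> h : isProp i A. \<^bold>\<lambda> x : A. \<^bold>\<lambda> y : A. \<^bold>\<lambda> p : EqE i A x y. \<^bold>\<lambda> q : EqE i A x y.
      concatE i (EqE i A x y) p (concatE i A x x y (invE i A x x (h \<cdot> x \<cdot> x)) (h \<cdot> x \<cdot> y)) q
        (pp \<cdot> A \<cdot> h \<cdot> x \<cdot> y \<cdot> p)
        (invE i (EqE i A x y) q (concatE i A x x y (invE i A x x (h \<cdot> x \<cdot> x)) (h \<cdot> x \<cdot> y)) (pp \<cdot> A \<cdot> h \<cdot> x \<cdot> y \<cdot> q))"])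
    (simp_all only: laws checking_eqs cong: conj_left_cong)

text \<open>The eliminator of the set truncation needs a family of sets. A family of identity types in a set is a family of
propositions, hence of sets.\<close>

definition strunc_ext_law :: "nat \<Rightarrow> exp" where [laws]:
  "strunc_ext_law i = (\<^bold>\<Pi> A : Type i. \<^bold>\<Pi> S : Type i. isSet i S \<rightarrow> (\<^bold>\<Pi> f : STruncE i A \<rightarrow> S. \<^bold>\<Pi> g : STruncE i A \<rightarrow> S.
     (\<^bold>\<Pi> a : A. EqE i S (f \<cdot> sinE i A a) (g \<cdot> sinE i A a)) \<rightarrow>
     (\<^bold>\<Pi> x : STruncE i A. EqE i S (f \<cdot> x) (g \<cdot> x))))"

lemma strunc_ext: "inhabited (strunc_ext_law i)"
  by (rule inhabited_from1[OF prop_is_set[of i], where i = i and t = "\<^bold>\<lambda> ps : prop_is_set_law i.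
      \<^bold>\<lambda> A : Type i. \<^bold>\<lambda> S : Type i. \<^bold>\<lambda> s : isSet i S. \<^bold>\<lambda> f : STruncE i A \<rightarrow> S. \<^bold>\<lambda> g : STruncE i A \<rightarrow> S.
      \<^bold>\<lambda> h : (\<^bold>\<Pi> a : A. EqE i S (f \<cdot> sinE i A a) (g \<cdot> sinE i A a)). \<^bold>\<lambda> x : STruncE i A.
      K (CSInd i i) \<cdot> A \<cdot> (\<^bold>\<lambda> x : STruncE i A. EqE i S (f \<cdot> x) (g \<cdot> x))
        \<cdot> (\<^bold>\<lambda> x : STruncE i A. ps \<cdot> EqE i S (f \<cdot> x) (g \<cdot> x) \<cdot> (s \<cdot> (f \<cdot> x) \<cdot> (g \<cdot> x))) \<cdot> h \<cdot> x"])
    (simp_all only: laws checking_eqs cong: conj_left_cong)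

definition strunc_right_unit_law :: "nat \<Rightarrow> exp" where [laws]:
  "strunc_right_unit_law i = (\<^bold>\<Pi> A : Type i. \<^bold>\<Pi> x : A. \<^bold>\<Pi> y : A. \<^bold>\<Pi> p : EqE i A x y.
     EqE i (STruncE i (EqE i A x y)) (sinE i (EqE i A x y) (concatE i A x y y p (reflE i A y))) (sinE i (EqE i A x y) p))"

lemma strunc_right_unit: "inhabited (strunc_right_unit_law i)"
  by (rule inhabited_from1[OF right_unit[of i], where i = i and t = "\<^bold>\<lambda> ru : right_unit_law i.
      \<^bold>\<lambda> A : Type i. \<^bold>\<lambda> x : A. \<^bold>\<lambda> y : A. \<^bold>\<lambda> p : EqE i A x y.
      apE i (EqE i A x y) (STruncE i (EqE i A x y)) (\<lambda>z. sinE i (EqE i A x y) z)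
        (concatE i A x y y p (reflE i A y)) p (ru \<cdot> A \<cdot> x \<cdot> y \<cdot> p)"])
    (simp_all only: laws checking_eqs cong: conj_left_cong)

section \<open>Commuting loops and conjugation\<close>

text \<open>Transporting a loop back along \<open>r\<close> is conjugation by \<open>r\<close>. For \<open>r : x = y\<close> between different end points this has a proof by
path induction: if \<open>r\<close> is reflexivity the transport is the identity and the hypothesis says \<open>q = q'\<close> up to the right unit
law. The case \<open>y = x\<close>, \<open>q' = q\<close> relates the action to commutation.\<close>

definition comm_fixed_law :: "nat \<Rightarrow> exp" where [laws]:
  "comm_fixed_law i = (\<^bold>\<Pi> X : Type i. \<^bold>\<Pi> x : X. \<^bold>\<Pi> y : X. \<^bold>\<Pi> r : EqE i X x y. \<^bold>\<Pi> q : EqE i X y y. \<^bold>\<Pi> q' : EqE i X x x.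
     EqE i (STruncE i (EqE i X x y)) (sinE i (EqE i X x y) (concatE i X x y y r q)) (sinE i (EqE i X x y) (concatE i X x x y q' r)) \<rightarrow>
     EqE i (STruncE i (EqE i X x x)) (transportE i X (\<lambda>z. STruncE i (EqE i X z z)) y x (invE i X x y r) (sinE i (EqE i X y y) q))
       (sinE i (EqE i X x x) q'))"

lemma comm_fixed: "inhabited (comm_fixed_law i)"
  by (rule inhabited_from1[OF strunc_right_unit[of i], where i = i and t = "\<^bold>\<lambda> ru : strunc_right_unit_law i.
      \<^bold>\<lambda> X : Type i. \<^bold>\<lambda> x : X. \<^bold>\<lambda> y : X. \<^bold>\<lambda> r : EqE i X x y.
      JE i X (\<lambda>x y r. \<^bold>\<Pi> q : EqE i X y y. \<^bold>\<Pi> q' : EqE i X x x.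
     EqE i (STruncE i (EqE i X x y)) (sinE i (EqE i X x y) (concatE i X x y y r q)) (sinE i (EqE i X x y) (concatE i X x x y q' r)) \<rightarrow>
     EqE i (STruncE i (EqE i X x x)) (transportE i X (\<lambda>z. STruncE i (EqE i X z z)) y x (invE i X x y r) (sinE i (EqE i X y y) q))
       (sinE i (EqE i X x x) q'))
      (\<lambda>x. \<^bold>\<lambda> q : EqE i X x x. \<^bold>\<lambda> q' : EqE i X x x.
        \<^bold>\<lambda> h : EqE i (STruncE i (EqE i X x x)) (sinE i (EqE i X x x) q) (sinE i (EqE i X x x) (concatE i X x x x q' (reflE i X x))).
        concatE i (STruncE i (EqE i X x x)) (sinE i (EqE i X x x) q) (sinE i (EqE i X x x) (concatE i X x x x q' (reflE i X x)))
          (sinE i (EqE i X x x) q') h (ru \<cdot> X \<cdot> x \<cdot> x \<cdot> q')) x y r"])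
    (simp_all only: laws checking_eqs cong: conj_left_cong)

definition fixed_comm_law :: "nat \<Rightarrow> exp" where [laws]:
  "fixed_comm_law i = (\<^bold>\<Pi> X : Type i. \<^bold>\<Pi> x : X. \<^bold>\<Pi> y : X. \<^bold>\<Pi> r : EqE i X x y. \<^bold>\<Pi> q : EqE i X y y. \<^bold>\<Pi> q' : EqE i X x x.
     EqE i (STruncE i (EqE i X x x)) (transportE i X (\<lambda>z. STruncE i (EqE i X z z)) y x (invE i X x y r) (sinE i (EqE i X y y) q))
       (sinE i (EqE i X x x) q') \<rightarrow>
     EqE i (STruncE i (EqE i X x y)) (sinE i (EqE i X x y) (concatE i X x y y r q)) (sinE i (EqE i X x y) (concatE i X x x y q' r)))"

lemma fixed_comm: "inhabited (fixed_comm_law i)"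
  by (rule inhabited_from1[OF strunc_right_unit[of i], where i = i and t = "\<^bold>\<lambda> ru : strunc_right_unit_law i.
      \<^bold>\<lambda> X : Type i. \<^bold>\<lambda> x : X. \<^bold>\<lambda> y : X. \<^bold>\<lambda> r : EqE i X x y.
      JE i X (\<lambda>x y r. \<^bold>\<Pi> q : EqE i X y y. \<^bold>\<Pi> q' : EqE i X x x.
     EqE i (STruncE i (EqE i X x x)) (transportE i X (\<lambda>z. STruncE i (EqE i X z z)) y x (invE i X x y r) (sinE i (EqE i X y y) q))
       (sinE i (EqE i X x x) q') \<rightarrow>
     EqE i (STruncE i (EqE i X x y)) (sinE i (EqE i X x y) (concatE i X x y y r q)) (sinE i (EqE i X x y) (concatE i X x x y q' r)))
      (\<lambda>x. \<^bold>\<lambda> q : EqE i X x x. \<^bold>\<lambda> q' : EqE i X x x.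
        \<^bold>\<lambda> h : EqE i (STruncE i (EqE i X x x)) (sinE i (EqE i X x x) q) (sinE i (EqE i X x x) q').
        concatE i (STruncE i (EqE i X x x)) (sinE i (EqE i X x x) q) (sinE i (EqE i X x x) q')
          (sinE i (EqE i X x x) (concatE i X x x x q' (reflE i X x))) h
          (invE i (STruncE i (EqE i X x x)) (sinE i (EqE i X x x) (concatE i X x x x q' (reflE i X x))) (sinE i (EqE i X x x) q')
             (ru \<cdot> X \<cdot> x \<cdot> x \<cdot> q'))) x y r"])
    (simp_all only: laws checking_eqs cong: conj_left_cong)

text \<open>The action, multiplication and triviality of the action once more, with the first iterated loop space replaced by the
identity type to which it computes and an arbitrary family \<open>F\<close> in place of a higher loop space.\<close>

definition act_path :: "nat \<Rightarrow> exp \<Rightarrow> (exp \<Rightarrow> exp) \<Rightarrow> exp \<Rightarrow> exp \<Rightarrow> exp \<Rightarrow> exp" where [laws]: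
  "act_path i X F x g u = srecE i (EqE i X x x) (F x)
     (\<lambda>p. transportE i X (\<lambda>z. STruncE i (F z)) x x (invE i X x x p) u) g"

definition mult_path :: "nat \<Rightarrow> exp \<Rightarrow> exp \<Rightarrow> exp \<Rightarrow> exp \<Rightarrow> exp" where [laws]:
  "mult_path i X x g h = srecE i (EqE i X x x) (EqE i X x x)
     (\<lambda>p. srecE i (EqE i X x x) (EqE i X x x) (\<lambda>q. sinE i (EqE i X x x) (concatE i X x x x p q)) h) g"

definition abelian_path :: "nat \<Rightarrow> exp \<Rightarrow> exp \<Rightarrow> exp" where [laws]:
  "abelian_path i X x = (\<^bold>\<Pi> g : STruncE i (EqE i X x x). \<^bold>\<Pi> h : STruncE i (EqE i X x x).
     EqE i (STruncE i (EqE i X x x)) (mult_path i X x g h) (mult_path i X x h g))"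

definition trivial_path :: "nat \<Rightarrow> exp \<Rightarrow> (exp \<Rightarrow> exp) \<Rightarrow> exp \<Rightarrow> exp" where [laws]:
  "trivial_path i X F x = (\<^bold>\<Pi> g : STruncE i (EqE i X x x). \<^bold>\<Pi> u : STruncE i (F x).
     EqE i (STruncE i (F x)) (act_path i X F x g u) u)"

text \<open>By extensionality for maps out of set truncations it suffices to consider classes of loops \<open>p\<close> and \<open>q\<close>. There the
action is transport along the inverse of \<open>p\<close>, and commutativity is applied to the classes of \<open>p\<close> and \<open>q\<close>.\<close>

definition abelian_trivial_law :: "nat \<Rightarrow> exp" where [laws]:
  "abelian_trivial_law i = (\<^bold>\<Pi> X : Type i. \<^bold>\<Pi> x : X. abelian_path i X x \<rightarrow> trivial_path i X (\<lambda>z. EqE i X z z) x)"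

lemma abelian_trivial: "inhabited (abelian_trivial_law i)"
  by (rule inhabited_from2[OF strunc_ext[of i] comm_fixed[of i], where i = i and t = "\<^bold>\<lambda> ext : strunc_ext_law i. \<^bold>\<lambda> cf : comm_fixed_law i.
      \<^bold>\<lambda> X : Type i. \<^bold>\<lambda> x : X. \<^bold>\<lambda> ab : abelian_path i X x.
      \<^bold>\<lambda> g : STruncE i (EqE i X x x). \<^bold>\<lambda> u : STruncE i (EqE i X x x).
      ext \<cdot> EqE i X x x \<cdot> STruncE i (EqE i X x x) \<cdot> (K (CSSet i) \<cdot> EqE i X x x)
        \<cdot> (\<^bold>\<lambda> g : STruncE i (EqE i X x x). act_path i X (\<lambda>z. EqE i X z z) x g u) \<cdot> (\<^bold>\<lambda> _ : STruncE i (EqE i X x x). u)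
        \<cdot> (\<^bold>\<lambda> p : EqE i X x x.
            ext \<cdot> EqE i X x x \<cdot> STruncE i (EqE i X x x) \<cdot> (K (CSSet i) \<cdot> EqE i X x x)
              \<cdot> (\<^bold>\<lambda> u : STruncE i (EqE i X x x). transportE i X (\<lambda>z. STruncE i (EqE i X z z)) x x (invE i X x x p) u)
              \<cdot> idE (STruncE i (EqE i X x x))
              \<cdot> (\<^bold>\<lambda> q : EqE i X x x. cf \<cdot> X \<cdot> x \<cdot> x \<cdot> p \<cdot> q \<cdot> q \<cdot> (ab \<cdot> sinE i (EqE i X x x) p \<cdot> sinE i (EqE i X x x) q))
              \<cdot> u)
        \<cdot> g"])
    (simp_all only: laws checking_eqs cong: conj_left_cong)

definition trivial_abelian_law :: "nat \<Rightarrow> exp" where [laws]: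
  "trivial_abelian_law i = (\<^bold>\<Pi> X : Type i. \<^bold>\<Pi> x : X. trivial_path i X (\<lambda>z. EqE i X z z) x \<rightarrow> abelian_path i X x)"

lemma trivial_abelian: "inhabited (trivial_abelian_law i)"
  by (rule inhabited_from2[OF strunc_ext[of i] fixed_comm[of i], where i = i and t = "\<^bold>\<lambda> ext : strunc_ext_law i. \<^bold>\<lambda> fc : fixed_comm_law i.
      \<^bold>\<lambda> X : Type i. \<^bold>\<lambda> x : X. \<^bold>\<lambda> tr : trivial_path i X (\<lambda>z. EqE i X z z) x.
      \<^bold>\<lambda> g : STruncE i (EqE i X x x). \<^bold>\<lambda> h : STruncE i (EqE i X x x).
      ext \<cdot> EqE i X x x \<cdot> STruncE i (EqE i X x x) \<cdot> (K (CSSet i) \<cdot> EqE i X x x)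
        \<cdot> (\<^bold>\<lambda> g : STruncE i (EqE i X x x). mult_path i X x g h) \<cdot> (\<^bold>\<lambda> g : STruncE i (EqE i X x x). mult_path i X x h g)
        \<cdot> (\<^bold>\<lambda> p : EqE i X x x.
            ext \<cdot> EqE i X x x \<cdot> STruncE i (EqE i X x x) \<cdot> (K (CSSet i) \<cdot> EqE i X x x)
              \<cdot> (\<^bold>\<lambda> h : STruncE i (EqE i X x x). mult_path i X x (sinE i (EqE i X x x) p) h)
              \<cdot> (\<^bold>\<lambda> h : STruncE i (EqE i X x x). mult_path i X x h (sinE i (EqE i X x x) p))
              \<cdot> (\<^bold>\<lambda> q : EqE i X x x. fc \<cdot> X \<cdot> x \<cdot> x \<cdot> p \<cdot> q \<cdot> q \<cdot> (tr \<cdot> sinE i (EqE i X x x) p \<cdot> sinE i (EqE i X x x) q))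
              \<cdot> h)
        \<cdot> g"])
    (simp_all only: laws checking_eqs cong: conj_left_cong)

section \<open>Pointed maps\<close>

text \<open>Pointed maps from \<open>(A, a)\<close> to \<open>(B, b)\<close>: a map together with a path from the image of \<open>a\<close> to \<open>b\<close>.\<close>

definition MapE :: "nat \<Rightarrow> exp \<Rightarrow> exp \<Rightarrow> exp \<Rightarrow> exp \<Rightarrow> exp" where [laws]:
  "MapE i A a B b = SigE i (A \<rightarrow> B) (\<lambda>f. EqE i B (f \<cdot> a) b)"

definition mapE :: "nat \<Rightarrow> exp \<Rightarrow> exp \<Rightarrow> exp \<Rightarrow> exp \<Rightarrow> exp \<Rightarrow> exp \<Rightarrow> exp" where [laws]:
  "mapE i A a B b f p = pairE i (A \<rightarrow> B) (\<lambda>f. EqE i B (f \<cdot> a) b) f p"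

definition map_fun :: "nat \<Rightarrow> exp \<Rightarrow> exp \<Rightarrow> exp \<Rightarrow> exp \<Rightarrow> exp \<Rightarrow> exp" where [laws]:
  "map_fun i A a B b m = fstE i (A \<rightarrow> B) (\<lambda>f. EqE i B (f \<cdot> a) b) m"

definition map_pt :: "nat \<Rightarrow> exp \<Rightarrow> exp \<Rightarrow> exp \<Rightarrow> exp \<Rightarrow> exp \<Rightarrow> exp" where [laws]:
  "map_pt i A a B b m = sndE i (A \<rightarrow> B) (\<lambda>f. EqE i B (f \<cdot> a) b) m"

definition idmap :: "nat \<Rightarrow> exp \<Rightarrow> exp \<Rightarrow> exp" where [laws]:
  "idmap i A a = mapE i A a A a (idE A) (reflE i A a)"

text \<open>The section of \<open>happly\<close> that function extensionality provides: every homotopy comes from a path between the functions.\<close>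

definition funext_law :: "nat \<Rightarrow> exp" where [laws]:
  "funext_law i = (\<^bold>\<Pi> A : Type i. \<^bold>\<Pi> B : Type i. \<^bold>\<Pi> f : A \<rightarrow> B. \<^bold>\<Pi> g : A \<rightarrow> B.
     \<^bold>\<Pi> h : (\<^bold>\<Pi> x : A. EqE i B (f \<cdot> x) (g \<cdot> x)).
       SigE i (EqE i (A \<rightarrow> B) f g) (\<lambda>k. EqE i (\<^bold>\<Pi> x : A. EqE i B (f \<cdot> x) (g \<cdot> x)) (happly i A (\<lambda>_. B) f g \<cdot> k) h))"

lemma funext: "inhabited (funext_law i)"
  by (rule inhabitedI[where i = i and t = "\<^bold>\<lambda> A : Type i. \<^bold>\<lambda> B : Type i. \<^bold>\<lambda> f : A \<rightarrow> B. \<^bold>\<lambda> g : A \<rightarrow> B.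
     \<^bold>\<lambda> h : (\<^bold>\<Pi> x : A. EqE i B (f \<cdot> x) (g \<cdot> x)).
     (let D = EqE i (A \<rightarrow> B) f g; C = (\<^bold>\<Pi> x : A. EqE i B (f \<cdot> x) (g \<cdot> x)); ha = happly i A (\<lambda>_. B) f g;
        R = (\<lambda>r. \<^bold>\<Pi> y : C. EqE i C (ha \<cdot> (r \<cdot> y)) y); L = (\<lambda>l. \<^bold>\<Pi> x : D. EqE i D (l \<cdot> (ha \<cdot> x)) x);
        inv = fstE i (SigE i (C \<rightarrow> D) R) (\<lambda>_. SigE i (C \<rightarrow> D) L) (K (CFunext i) \<cdot> A \<cdot> (\<^bold>\<lambda> _ : A. B) \<cdot> f \<cdot> g)
      in pairE i D (\<lambda>k. EqE i C (ha \<cdot> k) h) (fstE i (C \<rightarrow> D) R inv \<cdot> h) (sndE i (C \<rightarrow> D) R inv \<cdot> h))"])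
    (simp_all only: laws checking_eqs cong: conj_left_cong)

text \<open>With a path \<open>k\<close> between the functions available, path induction reduces to the case of equal functions. The base point
of the target is \<open>g a\<close>, so that the pointing of \<open>g\<close> is reflexivity.\<close>

definition map_happly_law :: "nat \<Rightarrow> exp" where [laws]:
  "map_happly_law i = (\<^bold>\<Pi> A : Type i. \<^bold>\<Pi> B : Type i. \<^bold>\<Pi> f : A \<rightarrow> B. \<^bold>\<Pi> g : A \<rightarrow> B. \<^bold>\<Pi> k : EqE i (A \<rightarrow> B) f g.
     \<^bold>\<Pi> a : A. \<^bold>\<Pi> p : EqE i B (f \<cdot> a) (g \<cdot> a).
       EqE i (EqE i B (f \<cdot> a) (g \<cdot> a)) (happly i A (\<lambda>_. B) f g \<cdot> k \<cdot> a) p \<rightarrow>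
       EqE i (MapE i A a B (g \<cdot> a)) (mapE i A a B (g \<cdot> a) f p) (mapE i A a B (g \<cdot> a) g (reflE i B (g \<cdot> a))))"

lemma map_happly: "inhabited (map_happly_law i)"
  by (rule inhabitedI[where i = i and t = "\<^bold>\<lambda> A : Type i. \<^bold>\<lambda> B : Type i. \<^bold>\<lambda> f : A \<rightarrow> B. \<^bold>\<lambda> g : A \<rightarrow> B. \<^bold>\<lambda> k : EqE i (A \<rightarrow> B) f g.
     JE i (A \<rightarrow> B) (\<lambda>f g k. \<^bold>\<Pi> a : A. \<^bold>\<Pi> p : EqE i B (f \<cdot> a) (g \<cdot> a).
       EqE i (EqE i B (f \<cdot> a) (g \<cdot> a)) (happly i A (\<lambda>_. B) f g \<cdot> k \<cdot> a) p \<rightarrow>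
       EqE i (MapE i A a B (g \<cdot> a)) (mapE i A a B (g \<cdot> a) f p) (mapE i A a B (g \<cdot> a) g (reflE i B (g \<cdot> a))))
      (\<lambda>g. \<^bold>\<lambda> a : A. \<^bold>\<lambda> p : EqE i B (g \<cdot> a) (g \<cdot> a).
        \<^bold>\<lambda> h : EqE i (EqE i B (g \<cdot> a) (g \<cdot> a)) (reflE i B (g \<cdot> a)) p.
        apE i (EqE i B (g \<cdot> a) (g \<cdot> a)) (MapE i A a B (g \<cdot> a)) (\<lambda>p. mapE i A a B (g \<cdot> a) g p)
          p (reflE i B (g \<cdot> a)) (invE i (EqE i B (g \<cdot> a) (g \<cdot> a)) (reflE i B (g \<cdot> a)) p h))
      f g k"])
    (simp_all only: laws checking_eqs cong: conj_left_cong)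

text \<open>A pointed map is equal to the identity, as a pointed map, as soon as there is a homotopy to the identity whose value at
the base point is the pointing. Function extensionality turns the homotopy into a path.\<close>

definition pointed_map_id_law :: "nat \<Rightarrow> exp" where [laws]:
  "pointed_map_id_law i = (\<^bold>\<Pi> A : Type i. \<^bold>\<Pi> a : A. \<^bold>\<Pi> f : A \<rightarrow> A. \<^bold>\<Pi> h : (\<^bold>\<Pi> x : A. EqE i A (f \<cdot> x) x). \<^bold>\<Pi> p : EqE i A (f \<cdot> a) a.
       EqE i (EqE i A (f \<cdot> a) a) (h \<cdot> a) p \<rightarrow>
       EqE i (MapE i A a A a) (mapE i A a A a f p) (idmap i A a))"

lemma pointed_map_id: "inhabited (pointed_map_id_law i)"
  by (rule inhabited_from2[OF funext[of i] map_happly[of i], where i = i and t = "\<^bold>\<lambda> fe : funext_law i. \<^bold>\<lambda> mh : map_happly_law i.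
     \<^bold>\<lambda> A : Type i. \<^bold>\<lambda> a : A. \<^bold>\<lambda> f : A \<rightarrow> A. \<^bold>\<lambda> h : (\<^bold>\<Pi> x : A. EqE i A (f \<cdot> x) x). \<^bold>\<lambda> p : EqE i A (f \<cdot> a) a.
     \<^bold>\<lambda> c : EqE i (EqE i A (f \<cdot> a) a) (h \<cdot> a) p.
     (let C = (\<^bold>\<Pi> x : A. EqE i A (f \<cdot> x) (idE A \<cdot> x)); D = EqE i (A \<rightarrow> A) f (idE A); ha = happly i A (\<lambda>_. A) f (idE A);
          S = fe \<cdot> A \<cdot> A \<cdot> f \<cdot> idE A \<cdot> h; k = fstE i D (\<lambda>k. EqE i C (ha \<cdot> k) h) S; e = sndE i D (\<lambda>k. EqE i C (ha \<cdot> k) h) S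
      in mh \<cdot> A \<cdot> A \<cdot> f \<cdot> idE A \<cdot> k \<cdot> a \<cdot> p
        \<cdot> concatE i (EqE i A (f \<cdot> a) a) (ha \<cdot> k \<cdot> a) (h \<cdot> a) p
            (apE i C (EqE i A (f \<cdot> a) a) (\<lambda>H. H \<cdot> a) (ha \<cdot> k) h e) c)"])
    (simp_all only: laws checking_eqs cong: conj_left_cong)

definition conjugateE :: "nat \<Rightarrow> exp \<Rightarrow> exp \<Rightarrow> exp \<Rightarrow> exp \<Rightarrow> exp \<Rightarrow> exp" where [laws]:
  "conjugateE i X x y r q = transportE i X (\<lambda>z. EqE i X z z) x y r q"

text \<open>A conjugate of reflexivity is reflexivity.\<close>

definition conjugate_reflE :: "nat \<Rightarrow> exp \<Rightarrow> exp \<Rightarrow> exp \<Rightarrow> exp \<Rightarrow> exp" where [laws]: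
  "conjugate_reflE i X x y r = JE i X (\<lambda>x y r. EqE i (EqE i X y y) (conjugateE i X x y r (reflE i X x)) (reflE i X y))
     (\<lambda>x. reflE i (EqE i X x x) (reflE i X x)) x y r"

text \<open>The action of the loop space functor on a pointed map \<open>(f, p)\<close>: apply \<open>f\<close> and conjugate by the path \<open>p\<close>.\<close>

definition loop_map :: "nat \<Rightarrow> exp \<Rightarrow> exp \<Rightarrow> exp \<Rightarrow> exp \<Rightarrow> exp \<Rightarrow> exp \<Rightarrow> exp" where [laws]:
  "loop_map i A a B b f p = mapE i (EqE i A a a) (reflE i A a) (EqE i B b b) (reflE i B b)
     (\<^bold>\<lambda> w : EqE i A a a. conjugateE i B (f \<cdot> a) b p (apE i A B (\<lambda>x. f \<cdot> x) a a w))
     (conjugate_reflE i B (f \<cdot> a) b p)"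

text \<open>Applying the identity to a path gives back the path only up to a path, and function extensionality enters through
the criterion for pointed maps. At reflexivity both sides of the coherence condition compute to reflexivity.\<close>

definition loop_map_id_law :: "nat \<Rightarrow> exp" where [laws]:
  "loop_map_id_law i = (\<^bold>\<Pi> A : Type i. \<^bold>\<Pi> a : A.
     EqE i (MapE i (EqE i A a a) (reflE i A a) (EqE i A a a) (reflE i A a))
       (loop_map i A a A a (idE A) (reflE i A a)) (idmap i (EqE i A a a) (reflE i A a)))"

lemma loop_map_id: "inhabited (loop_map_id_law i)"
  by (rule inhabited_from1[OF pointed_map_id[of i], where i = i and t = "\<^bold>\<lambda> mi : pointed_map_id_law i. \<^bold>\<lambda> A : Type i. \<^bold>\<lambda> a : A.
     mi \<cdot> EqE i A a a \<cdot> reflE i A a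
       \<cdot> (\<^bold>\<lambda> w : EqE i A a a. conjugateE i A a a (reflE i A a) (apE i A A (\<lambda>x. idE A \<cdot> x) a a w))
       \<cdot> (\<^bold>\<lambda> w : EqE i A a a. JE i A (\<lambda>x y w. EqE i (EqE i A x y) (apE i A A (\<lambda>x. idE A \<cdot> x) x y w) w)
            (\<lambda>x. reflE i (EqE i A x x) (reflE i A x)) a a w)
       \<cdot> conjugate_reflE i A a a (reflE i A a)
       \<cdot> reflE i (EqE i (EqE i A a a) (reflE i A a) (reflE i A a)) (reflE i (EqE i A a a) (reflE i A a))"])
    (simp_all only: laws checking_eqs cong: conj_left_cong)

definition loop_map_cong_law :: "nat \<Rightarrow> exp" where [laws]:
  "loop_map_cong_law i = (\<^bold>\<Pi> A : Type i. \<^bold>\<Pi> a : A. \<^bold>\<Pi> m : MapE i A a A a.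
     EqE i (MapE i A a A a) m (idmap i A a) \<rightarrow>
     EqE i (MapE i (EqE i A a a) (reflE i A a) (EqE i A a a) (reflE i A a))
       (loop_map i A a A a (map_fun i A a A a m) (map_pt i A a A a m)) (idmap i (EqE i A a a) (reflE i A a)))"

lemma loop_map_cong: "inhabited (loop_map_cong_law i)"
  by (rule inhabited_from1[OF loop_map_id[of i], where i = i and t = "\<^bold>\<lambda> li : loop_map_id_law i.
     \<^bold>\<lambda> A : Type i. \<^bold>\<lambda> a : A. \<^bold>\<lambda> m : MapE i A a A a. \<^bold>\<lambda> h : EqE i (MapE i A a A a) m (idmap i A a).
     (let P = EqE i A a a; c = reflE i A a; M = MapE i P c P c;
          lm = (\<lambda>m. loop_map i A a A a (map_fun i A a A a m) (map_pt i A a A a m))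
      in concatE i M (lm m) (lm (idmap i A a)) (idmap i P c) (apE i (MapE i A a A a) M lm m (idmap i A a) h) (li \<cdot> A \<cdot> a))"])
    (simp_all only: laws checking_eqs cong: conj_left_cong)

text \<open>In a loop space the distinction between free and pointed homotopies disappears. The value of \<open>h\<close> at reflexivity may
differ from \<open>p\<close> by a loop \<open>al\<close> at reflexivity; but such a loop spreads to a loop \<open>adj q\<close> at every \<open>q\<close>, by induction on
\<open>q\<close>, and correcting \<open>h\<close> by this family makes it pointed.\<close>

definition free_pointed_law :: "nat \<Rightarrow> exp" where [laws]:
  "free_pointed_law i = (\<^bold>\<Pi> X : Type i. \<^bold>\<Pi> x : X. \<^bold>\<Pi> f : EqE i X x x \<rightarrow> EqE i X x x.
     \<^bold>\<Pi> h : (\<^bold>\<Pi> q : EqE i X x x. EqE i (EqE i X x x) (f \<cdot> q) q). \<^bold>\<Pi> p : EqE i (EqE i X x x) (f \<cdot> reflE i X x) (reflE i X x).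
       EqE i (MapE i (EqE i X x x) (reflE i X x) (EqE i X x x) (reflE i X x))
         (mapE i (EqE i X x x) (reflE i X x) (EqE i X x x) (reflE i X x) f p) (idmap i (EqE i X x x) (reflE i X x)))"

lemma free_pointed: "inhabited (free_pointed_law i)"
  by (rule inhabited_from2[OF pointed_map_id[of i] cancel_inverse[of i], where i = i and t = "\<^bold>\<lambda> mi : pointed_map_id_law i. \<^bold>\<lambda> cl : cancel_inverse_law i.
     \<^bold>\<lambda> X : Type i. \<^bold>\<lambda> x : X. \<^bold>\<lambda> f : EqE i X x x \<rightarrow> EqE i X x x.
     \<^bold>\<lambda> h : (\<^bold>\<Pi> q : EqE i X x x. EqE i (EqE i X x x) (f \<cdot> q) q). \<^bold>\<lambda> p : EqE i (EqE i X x x) (f \<cdot> reflE i X x) (reflE i X x).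
     (let P = EqE i X x x; e = reflE i X x; al = concatE i P e (f \<cdot> e) e (invE i P (f \<cdot> e) e (h \<cdot> e)) p;
          adj = (\<lambda>q. JE i X (\<lambda>x y q. EqE i (EqE i X y y) (reflE i X y) (reflE i X y) \<rightarrow> EqE i (EqE i X x y) q q)
                  (\<lambda>x. \<^bold>\<lambda> b : EqE i (EqE i X x x) (reflE i X x) (reflE i X x). b) x x q \<cdot> al)
      in mi \<cdot> P \<cdot> e \<cdot> f \<cdot> (\<^bold>\<lambda> q : P. concatE i P (f \<cdot> q) q q (h \<cdot> q) (adj q)) \<cdot> p \<cdot> (cl \<cdot> P \<cdot> (f \<cdot> e) \<cdot> e \<cdot> (h \<cdot> e) \<cdot> e \<cdot> p))"])
    (simp_all only: laws checking_eqs cong: conj_left_cong)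

section \<open>Transport in families of pointed types\<close>

text \<open>Transport in a family \<open>F\<close> with section \<open>s\<close>, as a pointed map between the fibres.\<close>

definition fibre_map :: "nat \<Rightarrow> exp \<Rightarrow> (exp \<Rightarrow> exp) \<Rightarrow> (exp \<Rightarrow> exp) \<Rightarrow> exp \<Rightarrow> exp \<Rightarrow> exp \<Rightarrow> exp" where [laws]:
  "fibre_map i X F s x y r = JE i X (\<lambda>x y _. MapE i (F x) (s x) (F y) (s y)) (\<lambda>x. idmap i (F x) (s x)) x y r"

text \<open>Transport commutes with forming fibrewise loop spaces. After path induction this is the preservation of identities by
the loop space functor.\<close>

definition loop_fibre_map_law :: "nat \<Rightarrow> exp" where [laws]:
  "loop_fibre_map_law i = (\<^bold>\<Pi> X : Type i. \<^bold>\<Pi> F : X \<rightarrow> Type i. \<^bold>\<Pi> s : (\<^bold>\<Pi> x : X. F \<cdot> x). \<^bold>\<Pi> x : X. \<^bold>\<Pi> y : X. \<^bold>\<Pi> r : EqE i X x y.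
     EqE i (MapE i (EqE i (F \<cdot> x) (s \<cdot> x) (s \<cdot> x)) (reflE i (F \<cdot> x) (s \<cdot> x)) (EqE i (F \<cdot> y) (s \<cdot> y) (s \<cdot> y)) (reflE i (F \<cdot> y) (s \<cdot> y)))
       (fibre_map i X (\<lambda>z. EqE i (F \<cdot> z) (s \<cdot> z) (s \<cdot> z)) (\<lambda>z. reflE i (F \<cdot> z) (s \<cdot> z)) x y r)
       (loop_map i (F \<cdot> x) (s \<cdot> x) (F \<cdot> y) (s \<cdot> y)
         (map_fun i (F \<cdot> x) (s \<cdot> x) (F \<cdot> y) (s \<cdot> y) (fibre_map i X (\<lambda>z. F \<cdot> z) (\<lambda>z. s \<cdot> z) x y r))
         (map_pt i (F \<cdot> x) (s \<cdot> x) (F \<cdot> y) (s \<cdot> y) (fibre_map i X (\<lambda>z. F \<cdot> z) (\<lambda>z. s \<cdot> z) x y r))))"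

lemma loop_fibre_map: "inhabited (loop_fibre_map_law i)"
  by (rule inhabited_from1[OF loop_map_id[of i], where i = i and t = "\<^bold>\<lambda> li : loop_map_id_law i.
     \<^bold>\<lambda> X : Type i. \<^bold>\<lambda> F : X \<rightarrow> Type i. \<^bold>\<lambda> s : (\<^bold>\<Pi> x : X. F \<cdot> x). \<^bold>\<lambda> x : X. \<^bold>\<lambda> y : X. \<^bold>\<lambda> r : EqE i X x y.
     JE i X (\<lambda>x y r. EqE i (MapE i (EqE i (F \<cdot> x) (s \<cdot> x) (s \<cdot> x)) (reflE i (F \<cdot> x) (s \<cdot> x)) (EqE i (F \<cdot> y) (s \<cdot> y) (s \<cdot> y)) (reflE i (F \<cdot> y) (s \<cdot> y)))
       (fibre_map i X (\<lambda>z. EqE i (F \<cdot> z) (s \<cdot> z) (s \<cdot> z)) (\<lambda>z. reflE i (F \<cdot> z) (s \<cdot> z)) x y r)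
       (loop_map i (F \<cdot> x) (s \<cdot> x) (F \<cdot> y) (s \<cdot> y)
         (map_fun i (F \<cdot> x) (s \<cdot> x) (F \<cdot> y) (s \<cdot> y) (fibre_map i X (\<lambda>z. F \<cdot> z) (\<lambda>z. s \<cdot> z) x y r))
         (map_pt i (F \<cdot> x) (s \<cdot> x) (F \<cdot> y) (s \<cdot> y) (fibre_map i X (\<lambda>z. F \<cdot> z) (\<lambda>z. s \<cdot> z) x y r))))
      (\<lambda>x. invE i (MapE i (EqE i (F \<cdot> x) (s \<cdot> x) (s \<cdot> x)) (reflE i (F \<cdot> x) (s \<cdot> x)) (EqE i (F \<cdot> x) (s \<cdot> x) (s \<cdot> x)) (reflE i (F \<cdot> x) (s \<cdot> x)))
         (loop_map i (F \<cdot> x) (s \<cdot> x) (F \<cdot> x) (s \<cdot> x) (idE (F \<cdot> x)) (reflE i (F \<cdot> x) (s \<cdot> x)))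
         (idmap i (EqE i (F \<cdot> x) (s \<cdot> x) (s \<cdot> x)) (reflE i (F \<cdot> x) (s \<cdot> x)))
         (li \<cdot> (F \<cdot> x) \<cdot> (s \<cdot> x))) x y r"])
    (simp_all only: laws checking_eqs cong: conj_left_cong)

text \<open>The induction step for iterated loop spaces: if transport around \<open>r\<close> is the identity as a pointed map, then so is
transport around \<open>r\<close> in the family of loop spaces. Pointedness is what makes the hypothesis strong enough to be iterated.\<close>

definition loop_fibre_id_law :: "nat \<Rightarrow> exp" where [laws]:
  "loop_fibre_id_law i = (\<^bold>\<Pi> X : Type i. \<^bold>\<Pi> F : X \<rightarrow> Type i. \<^bold>\<Pi> s : (\<^bold>\<Pi> x : X. F \<cdot> x). \<^bold>\<Pi> x : X. \<^bold>\<Pi> r : EqE i X x x.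
     EqE i (MapE i (F \<cdot> x) (s \<cdot> x) (F \<cdot> x) (s \<cdot> x)) (fibre_map i X (\<lambda>z. F \<cdot> z) (\<lambda>z. s \<cdot> z) x x r) (idmap i (F \<cdot> x) (s \<cdot> x)) \<rightarrow>
     EqE i (MapE i (EqE i (F \<cdot> x) (s \<cdot> x) (s \<cdot> x)) (reflE i (F \<cdot> x) (s \<cdot> x)) (EqE i (F \<cdot> x) (s \<cdot> x) (s \<cdot> x)) (reflE i (F \<cdot> x) (s \<cdot> x)))
       (fibre_map i X (\<lambda>z. EqE i (F \<cdot> z) (s \<cdot> z) (s \<cdot> z)) (\<lambda>z. reflE i (F \<cdot> z) (s \<cdot> z)) x x r)
       (idmap i (EqE i (F \<cdot> x) (s \<cdot> x) (s \<cdot> x)) (reflE i (F \<cdot> x) (s \<cdot> x))))"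

lemma loop_fibre_id: "inhabited (loop_fibre_id_law i)"
  by (rule inhabited_from2[OF loop_fibre_map[of i] loop_map_cong[of i], where i = i and t = "\<^bold>\<lambda> lf : loop_fibre_map_law i. \<^bold>\<lambda> li : loop_map_cong_law i.
     \<^bold>\<lambda> X : Type i. \<^bold>\<lambda> F : X \<rightarrow> Type i. \<^bold>\<lambda> s : (\<^bold>\<Pi> x : X. F \<cdot> x). \<^bold>\<lambda> x : X. \<^bold>\<lambda> r : EqE i X x x.
     \<^bold>\<lambda> h : EqE i (MapE i (F \<cdot> x) (s \<cdot> x) (F \<cdot> x) (s \<cdot> x)) (fibre_map i X (\<lambda>z. F \<cdot> z) (\<lambda>z. s \<cdot> z) x x r) (idmap i (F \<cdot> x) (s \<cdot> x)).
     (let A = F \<cdot> x; a = s \<cdot> x; P = EqE i A a a; c = reflE i A a;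
          m = fibre_map i X (\<lambda>z. F \<cdot> z) (\<lambda>z. s \<cdot> z) x x r
      in concatE i (MapE i P c P c) (fibre_map i X (\<lambda>z. EqE i (F \<cdot> z) (s \<cdot> z) (s \<cdot> z)) (\<lambda>z. reflE i (F \<cdot> z) (s \<cdot> z)) x x r)
        (loop_map i A a A a (map_fun i A a A a m) (map_pt i A a A a m)) (idmap i P c)
        (lf \<cdot> X \<cdot> F \<cdot> s \<cdot> x \<cdot> x \<cdot> r) (li \<cdot> A \<cdot> a \<cdot> m \<cdot> h))"])
    (simp_all only: laws checking_eqs cong: conj_left_cong)

text \<open>The link between the action, which is transport in set truncations, and transport as a pointed map.\<close>

definition transport_strunc_law :: "nat \<Rightarrow> exp" where [laws]:
  "transport_strunc_law i = (\<^bold>\<Pi> X : Type i. \<^bold>\<Pi> F : X \<rightarrow> Type i. \<^bold>\<Pi> s : (\<^bold>\<Pi> x : X. F \<cdot> x). \<^bold>\<Pi> x : X. \<^bold>\<Pi> y : X. \<^bold>\<Pi> r : EqE i X x y. \<^bold>\<Pi> w : F \<cdot> x.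
     EqE i (STruncE i (F \<cdot> y)) (transportE i X (\<lambda>z. STruncE i (F \<cdot> z)) x y r (sinE i (F \<cdot> x) w))
       (sinE i (F \<cdot> y) (map_fun i (F \<cdot> x) (s \<cdot> x) (F \<cdot> y) (s \<cdot> y) (fibre_map i X (\<lambda>z. F \<cdot> z) (\<lambda>z. s \<cdot> z) x y r) \<cdot> w)))"

lemma transport_strunc: "inhabited (transport_strunc_law i)"
  by (rule inhabitedI[where i = i and t = "\<^bold>\<lambda> X : Type i. \<^bold>\<lambda> F : X \<rightarrow> Type i. \<^bold>\<lambda> s : (\<^bold>\<Pi> x : X. F \<cdot> x). \<^bold>\<lambda> x : X. \<^bold>\<lambda> y : X. \<^bold>\<lambda> r : EqE i X x y.
     JE i X (\<lambda>x y r. \<^bold>\<Pi> w : F \<cdot> x. EqE i (STruncE i (F \<cdot> y)) (transportE i X (\<lambda>z. STruncE i (F \<cdot> z)) x y r (sinE i (F \<cdot> x) w))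
       (sinE i (F \<cdot> y) (map_fun i (F \<cdot> x) (s \<cdot> x) (F \<cdot> y) (s \<cdot> y) (fibre_map i X (\<lambda>z. F \<cdot> z) (\<lambda>z. s \<cdot> z) x y r) \<cdot> w)))
     (\<lambda>x. \<^bold>\<lambda> w : F \<cdot> x. reflE i (STruncE i (F \<cdot> x)) (sinE i (F \<cdot> x) w)) x y r"])
    (simp_all only: laws checking_eqs cong: conj_left_cong)

text \<open>The equation is between elements of a set truncation, so it may be tested on classes of a loop \<open>p\<close> and of a point \<open>w\<close>
of the fibre, where the action is transport around the inverse of \<open>p\<close>.\<close>

definition fibre_id_trivial_law :: "nat \<Rightarrow> exp" where [laws]:
  "fibre_id_trivial_law i = (\<^bold>\<Pi> X : Type i. \<^bold>\<Pi> F : X \<rightarrow> Type i. \<^bold>\<Pi> s : (\<^bold>\<Pi> x : X. F \<cdot> x). \<^bold>\<Pi> x : X.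
     (\<^bold>\<Pi> r : EqE i X x x. EqE i (MapE i (F \<cdot> x) (s \<cdot> x) (F \<cdot> x) (s \<cdot> x)) (fibre_map i X (\<lambda>z. F \<cdot> z) (\<lambda>z. s \<cdot> z) x x r) (idmap i (F \<cdot> x) (s \<cdot> x))) \<rightarrow>
     trivial_path i X (\<lambda>z. F \<cdot> z) x)"

lemma fibre_id_trivial: "inhabited (fibre_id_trivial_law i)"
  by (rule inhabited_from2[OF strunc_ext[of i] transport_strunc[of i], where i = i and t = "\<^bold>\<lambda> ext : strunc_ext_law i. \<^bold>\<lambda> tf : transport_strunc_law i.
     \<^bold>\<lambda> X : Type i. \<^bold>\<lambda> F : X \<rightarrow> Type i. \<^bold>\<lambda> s : (\<^bold>\<Pi> x : X. F \<cdot> x). \<^bold>\<lambda> x : X.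
     \<^bold>\<lambda> h : (\<^bold>\<Pi> r : EqE i X x x. EqE i (MapE i (F \<cdot> x) (s \<cdot> x) (F \<cdot> x) (s \<cdot> x)) (fibre_map i X (\<lambda>z. F \<cdot> z) (\<lambda>z. s \<cdot> z) x x r) (idmap i (F \<cdot> x) (s \<cdot> x))).
     \<^bold>\<lambda> g : STruncE i (EqE i X x x). \<^bold>\<lambda> u : STruncE i (F \<cdot> x).
     (let A = F \<cdot> x; a = s \<cdot> x; S = STruncE i A; m = (\<lambda>r. fibre_map i X (\<lambda>z. F \<cdot> z) (\<lambda>z. s \<cdot> z) x x r);
          tr = (\<lambda>p u. transportE i X (\<lambda>z. STruncE i (F \<cdot> z)) x x (invE i X x x p) u);
          ev = (\<lambda>m w. sinE i A (map_fun i A a A a m \<cdot> w))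
      in ext \<cdot> EqE i X x x \<cdot> S \<cdot> (K (CSSet i) \<cdot> A)
        \<cdot> (\<^bold>\<lambda> g : STruncE i (EqE i X x x). act_path i X (\<lambda>z. F \<cdot> z) x g u) \<cdot> (\<^bold>\<lambda> _ : STruncE i (EqE i X x x). u)
        \<cdot> (\<^bold>\<lambda> p : EqE i X x x.
            ext \<cdot> A \<cdot> S \<cdot> (K (CSSet i) \<cdot> A) \<cdot> (\<^bold>\<lambda> u : S. tr p u) \<cdot> idE S
              \<cdot> (\<^bold>\<lambda> w : A. concatE i S (tr p (sinE i A w)) (ev (m (invE i X x x p)) w) (sinE i A w)
                   (tf \<cdot> X \<cdot> F \<cdot> s \<cdot> x \<cdot> x \<cdot> invE i X x x p \<cdot> w)
                   (apE i (MapE i A a A a) S (\<lambda>m. ev m w) (m (invE i X x x p)) (idmap i A a) (h \<cdot> invE i X x x p)))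
              \<cdot> u)
        \<cdot> g)"])
    (simp_all only: laws checking_eqs cong: conj_left_cong)

text \<open>The analogue of the passage from commutation to transport above, without truncations and with \<open>r\<close> in the forward
direction.\<close>

definition comm_conj_law :: "nat \<Rightarrow> exp" where [laws]:
  "comm_conj_law i = (\<^bold>\<Pi> X : Type i. \<^bold>\<Pi> x : X. \<^bold>\<Pi> y : X. \<^bold>\<Pi> r : EqE i X x y. \<^bold>\<Pi> q : EqE i X x x. \<^bold>\<Pi> q' : EqE i X y y.
     EqE i (EqE i X x y) (concatE i X x x y q r) (concatE i X x y y r q') \<rightarrow> EqE i (EqE i X y y) (conjugateE i X x y r q) q')"

lemma comm_conj: "inhabited (comm_conj_law i)"
  by (rule inhabited_from1[OF right_unit[of i], where i = i and t = "\<^bold>\<lambda> ru : right_unit_law i.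
     \<^bold>\<lambda> X : Type i. \<^bold>\<lambda> x : X. \<^bold>\<lambda> y : X. \<^bold>\<lambda> r : EqE i X x y.
     JE i X (\<lambda>x y r. \<^bold>\<Pi> q : EqE i X x x. \<^bold>\<Pi> q' : EqE i X y y.
        EqE i (EqE i X x y) (concatE i X x x y q r) (concatE i X x y y r q') \<rightarrow> EqE i (EqE i X y y) (conjugateE i X x y r q) q')
      (\<lambda>x. \<^bold>\<lambda> q : EqE i X x x. \<^bold>\<lambda> q' : EqE i X x x. \<^bold>\<lambda> h : EqE i (EqE i X x x) (concatE i X x x x q (reflE i X x)) q'.
         concatE i (EqE i X x x) q (concatE i X x x x q (reflE i X x)) q'
           (invE i (EqE i X x x) (concatE i X x x x q (reflE i X x)) q (ru \<cdot> X \<cdot> x \<cdot> x \<cdot> q)) h) x y r"])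
    (simp_all only: laws checking_eqs cong: conj_left_cong)

definition fibre_map_loops_law :: "nat \<Rightarrow> exp" where [laws]:
  "fibre_map_loops_law i = (\<^bold>\<Pi> X : Type i. \<^bold>\<Pi> x : X. \<^bold>\<Pi> y : X. \<^bold>\<Pi> r : EqE i X x y.
     EqE i (MapE i (EqE i X x x) (reflE i X x) (EqE i X y y) (reflE i X y))
       (fibre_map i X (\<lambda>z. EqE i X z z) (\<lambda>z. reflE i X z) x y r)
       (mapE i (EqE i X x x) (reflE i X x) (EqE i X y y) (reflE i X y) (\<^bold>\<lambda> q : EqE i X x x. conjugateE i X x y r q) (conjugate_reflE i X x y r)))"

lemma fibre_map_loops: "inhabited (fibre_map_loops_law i)"
  by (rule inhabitedI[where i = i and t = "\<^bold>\<lambda> X : Type i. \<^bold>\<lambda> x : X. \<^bold>\<lambda> y : X. \<^bold>\<lambda> r : EqE i X x y.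
     JE i X (\<lambda>x y r. EqE i (MapE i (EqE i X x x) (reflE i X x) (EqE i X y y) (reflE i X y))
       (fibre_map i X (\<lambda>z. EqE i X z z) (\<lambda>z. reflE i X z) x y r)
       (mapE i (EqE i X x x) (reflE i X x) (EqE i X y y) (reflE i X y) (\<^bold>\<lambda> q : EqE i X x x. conjugateE i X x y r q) (conjugate_reflE i X x y r)))
      (\<lambda>x. reflE i (MapE i (EqE i X x x) (reflE i X x) (EqE i X x x) (reflE i X x)) (idmap i (EqE i X x x) (reflE i X x))) x y r"])
    (simp_all only: laws checking_eqs cong: conj_left_cong)

text \<open>The start of the induction: transport in the family of loop spaces is conjugation, which commutativity makes freely
homotopic to the identity and therefore equal to it as a pointed map.\<close>

definition comm_fibre_id_law :: "nat \<Rightarrow> exp" where [laws]: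
  "comm_fibre_id_law i = (\<^bold>\<Pi> X : Type i. \<^bold>\<Pi> x : X. loops_commute i X x \<rightarrow> (\<^bold>\<Pi> r : EqE i X x x.
     EqE i (MapE i (EqE i X x x) (reflE i X x) (EqE i X x x) (reflE i X x))
       (fibre_map i X (\<lambda>z. EqE i X z z) (\<lambda>z. reflE i X z) x x r) (idmap i (EqE i X x x) (reflE i X x))))"

lemma comm_fibre_id: "inhabited (comm_fibre_id_law i)"
  by (rule inhabited_from3[OF fibre_map_loops[of i] free_pointed[of i] comm_conj[of i], where i = i and t = "\<^bold>\<lambda> fl : fibre_map_loops_law i. \<^bold>\<lambda> fp : free_pointed_law i. \<^bold>\<lambda> cc : comm_conj_law i.
     \<^bold>\<lambda> X : Type i. \<^bold>\<lambda> x : X. \<^bold>\<lambda> c : loops_commute i X x. \<^bold>\<lambda> r : EqE i X x x.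
     (let P = EqE i X x x; e = reflE i X x; f = (\<^bold>\<lambda> q : P. conjugateE i X x x r q)
      in concatE i (MapE i P e P e) (fibre_map i X (\<lambda>z. EqE i X z z) (\<lambda>z. reflE i X z) x x r)
           (mapE i P e P e f (conjugate_reflE i X x x r)) (idmap i P e) (fl \<cdot> X \<cdot> x \<cdot> x \<cdot> r)
           (fp \<cdot> X \<cdot> x \<cdot> f \<cdot> (\<^bold>\<lambda> q : P. cc \<cdot> X \<cdot> x \<cdot> x \<cdot> r \<cdot> q \<cdot> q \<cdot> (c \<cdot> q \<cdot> r)) \<cdot> conjugate_reflE i X x x r))"])
    (simp_all only: laws checking_eqs cong: conj_left_cong)

text \<open>The base case is about the loop space itself, because \<open>n\<close> counts from the first loop space.\<close>

definition comm_iterated_law :: "nat \<Rightarrow> exp" where [laws]: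
  "comm_iterated_law i = (\<^bold>\<Pi> X : Type i. \<^bold>\<Pi> x : X. \<^bold>\<Pi> c : loops_commute i X x. \<^bold>\<Pi> r : EqE i X x x. \<^bold>\<Pi> n : NatE.
     (let F = (\<lambda>z. carrierE i (LoopnE i (succE n) X z)); s = (\<lambda>z. pointE i (LoopnE i (succE n) X z))
      in EqE i (MapE i (F x) (s x) (F x) (s x)) (fibre_map i X F s x x r) (idmap i (F x) (s x))))"

lemma comm_iterated: "inhabited (comm_iterated_law i)"
  by (rule inhabited_from2[OF comm_fibre_id[of i] loop_fibre_id[of i], where i = i and t = "\<^bold>\<lambda> b : comm_fibre_id_law i. \<^bold>\<lambda> st : loop_fibre_id_law i.
     \<^bold>\<lambda> X : Type i. \<^bold>\<lambda> x : X. \<^bold>\<lambda> c : loops_commute i X x. \<^bold>\<lambda> r : EqE i X x x. \<^bold>\<lambda> n : NatE.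
     (let F = (\<lambda>n z. carrierE i (LoopnE i (succE n) X z)); s = (\<lambda>n z. pointE i (LoopnE i (succE n) X z));
          P = (\<lambda>n. EqE i (MapE i (F n x) (s n x) (F n x) (s n x)) (fibre_map i X (F n) (s n) x x r) (idmap i (F n x) (s n x)))
      in K (CNatInd i) \<cdot> (\<^bold>\<lambda> n : NatE. P n) \<cdot> (b \<cdot> X \<cdot> x \<cdot> c \<cdot> r)
        \<cdot> (\<^bold>\<lambda> n : NatE. st \<cdot> X \<cdot> (\<^bold>\<lambda> z : X. F n z) \<cdot> (\<^bold>\<lambda> z : X. s n z) \<cdot> x \<cdot> r) \<cdot> n)"])
    (simp_all only: laws checking_eqs cong: conj_left_cong)

section \<open>The three clauses\<close>

text \<open>Stated for an arbitrary map \<open>act\<close>, so that the group and the action enter the proof term for the first clause only once.\<close>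

definition contractible_trivial_law :: "nat \<Rightarrow> exp" where [laws]:
  "contractible_trivial_law i = (\<^bold>\<Pi> G : Type i. \<^bold>\<Pi> V : Type i. \<^bold>\<Pi> act : G \<rightarrow> V \<rightarrow> V. \<^bold>\<Pi> e : G.
     (\<^bold>\<Pi> g : G. EqE i G g e) \<rightarrow> (\<^bold>\<Pi> u : V. EqE i V (act \<cdot> e \<cdot> u) u) \<rightarrow> (\<^bold>\<Pi> g : G. \<^bold>\<Pi> u : V. EqE i V (act \<cdot> g \<cdot> u) u))"

lemma contractible_trivial: "inhabited (contractible_trivial_law i)"
  by (rule inhabitedI[where i = i and t = "\<^bold>\<lambda> G : Type i. \<^bold>\<lambda> V : Type i. \<^bold>\<lambda> act : G \<rightarrow> V \<rightarrow> V. \<^bold>\<lambda> e : G.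
     \<^bold>\<lambda> h : (\<^bold>\<Pi> g : G. EqE i G g e). \<^bold>\<lambda> b : (\<^bold>\<Pi> u : V. EqE i V (act \<cdot> e \<cdot> u) u). \<^bold>\<lambda> g : G. \<^bold>\<lambda> u : V.
     transportE i G (\<lambda>z. EqE i V (act \<cdot> z \<cdot> u) u) e g (invE i G g e (h \<cdot> g)) (b \<cdot> u)"])
    (simp_all only: laws checking_eqs cong: conj_left_cong)

text \<open>The equation to be proved is a proposition, being an identity type in a set, so the truncated hypothesis may be
used as if it were given.\<close>

definition ptrunc_trivial_law :: "nat \<Rightarrow> exp" where [laws]:
  "ptrunc_trivial_law i = (\<^bold>\<Pi> C : Type i. \<^bold>\<Pi> G : Type i. \<^bold>\<Pi> A : Type i. \<^bold>\<Pi> act : G \<rightarrow> STruncE i A \<rightarrow> STruncE i A.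
     (C \<rightarrow> (\<^bold>\<Pi> g : G. \<^bold>\<Pi> u : STruncE i A. EqE i (STruncE i A) (act \<cdot> g \<cdot> u) u)) \<rightarrow>
     PTruncE i C \<rightarrow> (\<^bold>\<Pi> g : G. \<^bold>\<Pi> u : STruncE i A. EqE i (STruncE i A) (act \<cdot> g \<cdot> u) u))"

lemma ptrunc_trivial: "inhabited (ptrunc_trivial_law i)"
  by (rule inhabitedI[where i = i and t = "\<^bold>\<lambda> C : Type i. \<^bold>\<lambda> G : Type i. \<^bold>\<lambda> A : Type i. \<^bold>\<lambda> act : G \<rightarrow> STruncE i A \<rightarrow> STruncE i A.
     \<^bold>\<lambda> h : C \<rightarrow> (\<^bold>\<Pi> g : G. \<^bold>\<Pi> u : STruncE i A. EqE i (STruncE i A) (act \<cdot> g \<cdot> u) u).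
     \<^bold>\<lambda> c : PTruncE i C. \<^bold>\<lambda> g : G. \<^bold>\<lambda> u : STruncE i A.
     K (CPInd i i) \<cdot> C \<cdot> (\<^bold>\<lambda> _ : PTruncE i C. EqE i (STruncE i A) (act \<cdot> g \<cdot> u) u)
       \<cdot> (\<^bold>\<lambda> _ : PTruncE i C. K (CSSet i) \<cdot> A \<cdot> (act \<cdot> g \<cdot> u) \<cdot> u) \<cdot> (\<^bold>\<lambda> c : C. h \<cdot> c \<cdot> g \<cdot> u) \<cdot> c"])
    (simp_all only: laws checking_eqs cong: conj_left_cong)

text \<open>The neutral element acts by transport along the inverse of reflexivity, which computes to the identity.\<close>

lemma simply_connected_trivial: "inhabited (\<^bold>\<Pi> X : Type i. \<^bold>\<Pi> x0 : X.
       simply_connected i X x0 \<rightarrow> (\<^bold>\<Pi> n : NatE. trivial_action i (succE n) X x0))"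
  by (rule inhabited_from1[OF contractible_trivial[of i], where i = i and t = "\<^bold>\<lambda> ct : contractible_trivial_law i.
     \<^bold>\<lambda> X : Type i. \<^bold>\<lambda> x : X. \<^bold>\<lambda> sc : simply_connected i X x. \<^bold>\<lambda> n : NatE.
       ct \<cdot> piE i oneE X x \<cdot> piE i (succE n) X x
       \<cdot> (\<^bold>\<lambda> g : piE i oneE X x. \<^bold>\<lambda> u : piE i (succE n) X x. actE i (succE n) X x g u)
       \<cdot> pi_unitE i oneE X x \<cdot> sndE i (connected i X) (\<lambda>_. trivial_pi1 i X x) sc
       \<cdot> (\<^bold>\<lambda> u : piE i (succE n) X x. reflE i (piE i (succE n) X x) u)"])
    (simp_all only: laws checking_eqs cong: conj_left_cong)

text \<open>The statements about identity types and those about the first iterated loop space differ only by computation.\<close>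

lemma abelian_iff_trivial: "inhabited (\<^bold>\<Pi> X : Type i. \<^bold>\<Pi> x0 : X.
       ProdE i (abelian_pi1 i X x0 \<rightarrow> trivial_action i oneE X x0)
               (trivial_action i oneE X x0 \<rightarrow> abelian_pi1 i X x0))"
  by (rule inhabited_from2[OF abelian_trivial[of i] trivial_abelian[of i], where i = i and t = "\<^bold>\<lambda> at : abelian_trivial_law i. \<^bold>\<lambda> ta : trivial_abelian_law i.
     \<^bold>\<lambda> X : Type i. \<^bold>\<lambda> x : X. pairE i (abelian_pi1 i X x \<rightarrow> trivial_action i oneE X x)
        (\<lambda>_. trivial_action i oneE X x \<rightarrow> abelian_pi1 i X x) (at \<cdot> X \<cdot> x) (ta \<cdot> X \<cdot> x)"])
    (simp_all only: laws checking_eqs cong: conj_left_cong)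

lemma loops_commute_trivial: "inhabited (\<^bold>\<Pi> X : Type i. \<^bold>\<Pi> x0 : X.
       PTruncE i (loops_commute i X x0) \<rightarrow> (\<^bold>\<Pi> n : NatE. trivial_action i (succE n) X x0))"
  by (rule inhabited_from3[OF ptrunc_trivial[of i] fibre_id_trivial[of i] comm_iterated[of i], where i = i and t = "
     \<^bold>\<lambda> pt : ptrunc_trivial_law i. \<^bold>\<lambda> ft : fibre_id_trivial_law i. \<^bold>\<lambda> cl : comm_iterated_law i.
     \<^bold>\<lambda> X : Type i. \<^bold>\<lambda> x : X. \<^bold>\<lambda> t : PTruncE i (loops_commute i X x). \<^bold>\<lambda> n : NatE.
     (let F = (\<lambda>z. carrierE i (LoopnE i (succE n) X z)); s = (\<lambda>z. pointE i (LoopnE i (succE n) X z))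
      in pt \<cdot> loops_commute i X x \<cdot> piE i oneE X x \<cdot> F x
        \<cdot> (\<^bold>\<lambda> g : piE i oneE X x. \<^bold>\<lambda> u : piE i (succE n) X x. actE i (succE n) X x g u)
        \<cdot> (\<^bold>\<lambda> c : loops_commute i X x. ft \<cdot> X \<cdot> (\<^bold>\<lambda> z : X. F z) \<cdot> (\<^bold>\<lambda> z : X. s z) \<cdot> x
             \<cdot> (\<^bold>\<lambda> r : EqE i X x x. cl \<cdot> X \<cdot> x \<cdot> c \<cdot> r \<cdot> n)) \<cdot> t)"])
    (simp_all only: laws checking_eqs cong: conj_left_cong)

theorem theorem16:
  fixes i :: nat
  shows
    "inhabited (\<^bold>\<Pi> X : Type i. \<^bold>\<Pi> x0 : X.
       simply_connected i X x0 \<rightarrow> (\<^bold>\<Pi> n : NatE. trivial_action i (succE n) X x0))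
   \<and> inhabited (\<^bold>\<Pi> X : Type i. \<^bold>\<Pi> x0 : X.
       ProdE i (abelian_pi1 i X x0 \<rightarrow> trivial_action i oneE X x0)
               (trivial_action i oneE X x0 \<rightarrow> abelian_pi1 i X x0))
   \<and> inhabited (\<^bold>\<Pi> X : Type i. \<^bold>\<Pi> x0 : X.
       PTruncE i (loops_commute i X x0) \<rightarrow> (\<^bold>\<Pi> n : NatE. trivial_action i (succE n) X x0))"
  using simply_connected_trivial abelian_iff_trivial loops_commute_trivial by blast

end
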